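(* Let $\alpha,\beta\in\,]0,1[$ be fixed. There are two explicit constants $\mathcal{C}_+=\mathcal{C}_+(\alpha,\beta,M)$ and $\mathcal{C}_-=\mathcal{C}_-(\alpha,\beta,M)$ for which the following holds. (1) There exists a level-$\alpha$ testing procedure $\tilde\Psi_{\alpha,2}$ such that $$\sup_{f_{(\varepsilon,\mu)}\in\mathcal F_2[M],\ \varepsilon\|\mu\|>\mathcal{C}_+ d^{1/4}/\sqrt{n}}\ \mathbb{P}_{f_{(\varepsilon,\mu)}}(\tilde\Psi_{\alpha,2}=0)\le\beta \quad\text{and}\quad \inf_{\Psi_\alpha}\ \sup_{f_{(\varepsilon,\mu)}\in\mathcal F_2[M],\ \varepsilon\|\mu\|>\mathcal{C}_- d^{1/4}/\sqrt{n}}\ \mathbb{P}_{f_{(\varepsilon,\mu)}}(\Psi_{\alpha}=0)>\beta ,$$ where the infimum is taken over all possible level-$\alpha$ testing procedures $\Psi_\alpha$. (2) Similarly, there exists a level-$\alpha$ testing procedure $\tilde\Psi_{\alpha,\infty}$ such that $$\sup_{f_{(\varepsilon,\mu)}\in\mathcal F_\infty[M],\ \varepsilon\|\mu\|_\infty>\mathcal{C}_+\sqrt{\ln(d)/n}}\ \mathbb{P}_{f_{(\varepsilon,\mu)}}(\tilde\Psi_{\alpha,\infty}=0)\le\beta \quad\text{and}\quad \inf_{\Psi_\alpha}\ \sup_{f_{(\varepsilon,\mu)}\in\mathcal F_\infty[M],\ \varepsilon\|\mu\|_\infty>\mathcal{C}_-\sqrt{\ln(d)/n}}\ \mathbb{P}_{f_{(\varepsilon,\mu)}}(\Psi_{\alpha}=0)>\beta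 ,$$ where again the infimum is taken over all level-$\alpha$ testing procedures $\Psi_\alpha$.
   Context: Let $M>0$ be given. Let $\phi_d$ be the density of the standard Gaussian distribution $\mathcal N_d(0_d,I_d)$ on $\mathbb{R}^d$. For $\varepsilon\in\,]0,1[$ and $\mu\in\mathbb{R}^d$ put $f_{(\varepsilon,\mu)}(x)=(1-\varepsilon)\phi_d(x)+\varepsilon\phi_d(x-\mu)$. Write $\|\mu\|=(\sum_{j=1}^d\mu_j^2)^{1/2}$, $\|\mu\|_\infty=\max_{1\le j\le d}|\mu_j|$, and $$\mathcal F_2[M]=\{f_{(\varepsilon,\mu)}:\varepsilon\in\,]0,1[,\ \|\mu\|\le M\},\qquad \mathcal F_\infty[M]=\{f_{(\varepsilon,\mu)}:\varepsilon\in\,]0,1[,\ \|\mu\|_\infty\le M\}.$$ One observes an i.i.d. sample $\underline X=(X_1,\dots,X_n)$ of $\mathbb{R}^d$-valued random vectors. For a density $g$ on $\mathbb{R}^d$, $\mathbb{P}_g$ is the probability when the common density of the $X_i$ is $g$; $\mathbb{P}_0:=\mathbb{P}_{\phi_d}$. A testing procedure $\Psi$ is a measurable function of $\underline X$ with values in $\{0,1\}$; it has level $\alpha$ (written $\Psi_\alpha$) if $\mathbb{P}_0(\Psi=1)\le\alpha$.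
   Formalization: Both lower bounds are stated for α+β<1 and a nonempty set of alternatives (they fail otherwise), with C₋>0; the upper bound in (2) is stated for d≥2, since ln(1)=0 makes it false for d=1 when α+β<1; the explicit constants are given by existence, depending only on α, β, M. *)

theory Defs
  imports "HOL-Probability.Probability"
begin

(* The constants of the theorem are uniform in the dimension d, so d has to be a term. A vector of
   R^d is therefore a function nat => real in the product space over {..<d} (undefined outside
   {..<d}), and a sample of size n is an element of the n-fold product of that space. *)

abbreviation lebesgue_Rd :: "nat \<Rightarrow> (nat \<Rightarrow> real) measure" where
  "lebesgue_Rd d \<equiv> (\<Pi>\<^sub>M j\<in>{..<d}. lborel)"

definition gauss_density :: "nat \<Rightarrow> (nat \<Rightarrow> real) \<Rightarrow> real" where
  "gauss_density d x = (\<Prod>j<d. std_normal_density (x j))"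

definition mixture_density :: "nat \<Rightarrow> real \<Rightarrow> (nat \<Rightarrow> real) \<Rightarrow> (nat \<Rightarrow> real) \<Rightarrow> real" where
  "mixture_density d \<epsilon> \<mu> x =
     (1 - \<epsilon>) * gauss_density d x + \<epsilon> * gauss_density d (\<lambda>j. x j - \<mu> j)"

definition norm2 :: "nat \<Rightarrow> (nat \<Rightarrow> real) \<Rightarrow> real" where
  "norm2 d \<mu> = L2_set \<mu> {..<d}"

(* Only meaningful for d >= 1. *)
definition norm_sup :: "nat \<Rightarrow> (nat \<Rightarrow> real) \<Rightarrow> real" where
  "norm_sup d \<mu> = Max ((\<lambda>j. \<bar>\<mu> j\<bar>) ` {..<d})"

(* The classes of mixtures are given by their parameters (\<epsilon>, \<mu>), since the separation conditions
   bear on the parameters; N is the norm, norm2 or norm_sup. *)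
definition mixture_class ::
    "(nat \<Rightarrow> (nat \<Rightarrow> real) \<Rightarrow> real) \<Rightarrow> nat \<Rightarrow> real \<Rightarrow> (real \<times> (nat \<Rightarrow> real)) set" where
  "mixture_class N d M =
     {(\<epsilon>, \<mu>). 0 < \<epsilon> \<and> \<epsilon> < 1 \<and> \<mu> \<in> {..<d} \<rightarrow>\<^sub>E UNIV \<and> N d \<mu> \<le> M}"

definition separated_class ::
    "(nat \<Rightarrow> (nat \<Rightarrow> real) \<Rightarrow> real) \<Rightarrow> nat \<Rightarrow> real \<Rightarrow> real \<Rightarrow> (real \<times> (nat \<Rightarrow> real)) set" where
  "separated_class N d M \<rho> = {(\<epsilon>, \<mu>) \<in> mixture_class N d M. \<epsilon> * N d \<mu> > \<rho>}"

definition sample_law ::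
    "nat \<Rightarrow> nat \<Rightarrow> ((nat \<Rightarrow> real) \<Rightarrow> real) \<Rightarrow> (nat \<Rightarrow> nat \<Rightarrow> real) measure" where
  "sample_law n d g = (\<Pi>\<^sub>M i\<in>{..<n}. density (lebesgue_Rd d) (\<lambda>x. ennreal (g x)))"

definition test_prob ::
    "nat \<Rightarrow> nat \<Rightarrow> ((nat \<Rightarrow> real) \<Rightarrow> real) \<Rightarrow> ((nat \<Rightarrow> nat \<Rightarrow> real) \<Rightarrow> nat) \<Rightarrow> nat \<Rightarrow> ennreal" where
  "test_prob n d g \<Psi> k =
     emeasure (sample_law n d g) {X \<in> space (sample_law n d g). \<Psi> X = k}"

definition tests :: "nat \<Rightarrow> nat \<Rightarrow> ((nat \<Rightarrow> nat \<Rightarrow> real) \<Rightarrow> nat) set" where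
  "tests n d = (\<Pi>\<^sub>M i\<in>{..<n}. lebesgue_Rd d) \<rightarrow>\<^sub>M count_space {0, 1}"

definition level_tests :: "nat \<Rightarrow> nat \<Rightarrow> real \<Rightarrow> ((nat \<Rightarrow> nat \<Rightarrow> real) \<Rightarrow> nat) set" where
  "level_tests n d \<alpha> = {\<Psi> \<in> tests n d. test_prob n d (gauss_density d) \<Psi> 1 \<le> ennreal \<alpha>}"

(* The supremum is taken in ennreal, so it is 0 over an empty set A. *)
definition worst_error ::
    "nat \<Rightarrow> nat \<Rightarrow> (real \<times> (nat \<Rightarrow> real)) set \<Rightarrow> ((nat \<Rightarrow> nat \<Rightarrow> real) \<Rightarrow> nat) \<Rightarrow> ennreal" where
  "worst_error n d A \<Psi> = (SUP (\<epsilon>, \<mu>)\<in>A. test_prob n d (mixture_density d \<epsilon> \<mu>) \<Psi> 0)"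

end

theory Submission
  imports Defs
begin

text \<open>
  The upper bounds come from two explicit tests. Write \<open>s = \<epsilon> * \<parallel>\<mu>\<parallel>\<close>; the mixture has mean
  \<open>\<epsilon> * \<mu>\<close> and covariance matrix \<open>I + \<epsilon> (1 - \<epsilon>) \<mu> \<mu>\<^sup>T\<close>. For the Euclidean norm the sample is
  split into two halves and the test compares the inner product of the two mean vectors with
  a threshold. By independence of the halves this statistic has mean \<open>s\<^sup>2\<close>, and its variance is at
  most a constant depending on \<open>M\<close> times \<open>d / n\<^sup>2 + s\<^sup>2 / n\<close>. Chebyshev's inequality thus separates
  the hypotheses as soon as \<open>s\<^sup>2\<close> exceeds a large multiple of \<open>sqrt d / n\<close>, which is where
  \<open>d powr (1/4) / sqrt n\<close> comes from (\<open>l2_upper_bound\<close>). For the sup norm the test looks for a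
  coordinate whose mean exceeds a multiple of \<open>sqrt (ln d / n)\<close> in absolute value: a Gaussian
  tail bound summed over the coordinates controls the level, and Chebyshev's inequality at the
  largest coordinate of \<open>\<mu>\<close> controls the other error (\<open>sup_upper_bound\<close>).
  
  The lower bounds use the second moment of a mixed likelihood ratio. Fix \<open>\<epsilon>\<close> and draw \<open>\<mu>\<close>
  uniformly from a finite family. If the averaged likelihood ratio with respect to the null
  hypothesis has second moment at most \<open>1 + \<eta>\<^sup>2\<close>, its distance to \<open>1\<close> is at most \<open>\<eta>\<close> in the mean,
  and no test of level \<open>\<alpha>\<close> has worst error below \<open>1 - \<alpha> - \<eta>\<close> (\<open>worst_error_lower_bound\<close>). For two
  vectors \<open>\<mu>\<close> and \<open>\<nu>\<close> the product of the likelihood ratios has the null expectation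
  \<open>(1 + \<epsilon>\<^sup>2 (exp \<langle>\<mu>, \<nu>\<rangle> - 1)) ^ n\<close>. All the vectors are given the largest norm, \<open>M\<close>, so that a
  weight \<open>\<epsilon>\<close> barely above \<open>\<rho> / M\<close> meets the separation \<open>\<rho>\<close>. For the Euclidean norm the
  vectors are \<open>M / sqrt d\<close> times sign vectors; then \<open>\<langle>\<mu>, \<nu>\<rangle>\<close> is \<open>M\<^sup>2 / d\<close> times a sum of \<open>d\<close>
  independent signs, of order \<open>M\<^sup>2 / sqrt d\<close>, and the second moment stays close to \<open>1\<close>
  while \<open>n \<epsilon>\<^sup>2\<close> is a small multiple of \<open>sqrt d\<close> (\<open>sign_prior_chi_square\<close>). For the sup norm the
  vectors are the multiples \<open>M e\<^sub>j\<close> of the unit vectors; only the fraction \<open>1 / d\<close> of equal pairs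
  contributes, with \<open>exp (n \<epsilon>\<^sup>2 (exp M\<^sup>2 - 1))\<close>, which is a small power of \<open>d\<close> while
  \<open>n \<epsilon>\<^sup>2\<close> is a small multiple of \<open>ln d\<close> (\<open>spike_prior_chi_square\<close>).
\<close>

section \<open>Integrals over finite product measures\<close>

lemma (in product_sigma_finite) has_bochner_integral_PiM_prod:
  fixes f :: "'i \<Rightarrow> 'a \<Rightarrow> real"
  assumes "finite I" and "\<And>i. i \<in> I \<Longrightarrow> has_bochner_integral (M i) (f i) (c i)"
  shows "has_bochner_integral (PiM I M) (\<lambda>x. \<Prod>i\<in>I. f i (x i)) (\<Prod>i\<in>I. c i)"
  using assms product_integrable_prod[of I f] product_integral_prod[of I f]
  by (simp add: has_bochner_integral_iff)

text \<open>
  A function of one factor is a product over all factors in which the others contribute the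
  constant \<open>1\<close>; the same device treats two distinct factors below.
\<close>

lemma (in product_prob_space) has_bochner_integral_PiM_component:
  fixes f :: "'a \<Rightarrow> real"
  assumes "finite I" "i \<in> I" "has_bochner_integral (M i) f a"
  shows "has_bochner_integral (PiM I M) (\<lambda>x. f (x i)) a"
proof -
  have "has_bochner_integral (PiM I M)
      (\<lambda>x. \<Prod>m\<in>I. if m = i then f (x m) else 1) (\<Prod>m\<in>I. if m = i then a else 1)"
    using assms
    by (intro has_bochner_integral_PiM_prod[where f="\<lambda>m y. if m = i then f y else 1"])
       (auto simp: has_bochner_integral_iff M.prob_space)
  then show ?thesis using assms by simp
qed

lemma (in product_prob_space) has_bochner_integral_PiM_two_components:
  fixes f g :: "'a \<Rightarrow> real"
  assumes "finite I" "i \<in> I" "k \<in> I" "i \<noteq> k"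
    and "has_bochner_integral (M i) f a" "has_bochner_integral (M k) g b"
  shows "has_bochner_integral (PiM I M) (\<lambda>x. f (x i) * g (x k)) (a * b)"
proof -
  have "has_bochner_integral (PiM I M)
      (\<lambda>x. \<Prod>m\<in>I. (if m = i then f (x m) else 1) * (if m = k then g (x m) else 1))
      (\<Prod>m\<in>I. (if m = i then a else 1) * (if m = k then b else 1))"
    using assms
    by (intro has_bochner_integral_PiM_prod[where
          f="\<lambda>m y. (if m = i then f y else 1) * (if m = k then g y else 1)"])
       (auto simp: has_bochner_integral_iff M.prob_space)
  then show ?thesis using assms by (simp add: prod.distrib)
qed

text \<open>
  Independence of two disjoint blocks of coordinates, used for the two halves of the sample.
\<close>

lemma (in product_prob_space) has_bochner_integral_PiM_disjoint_blocks:
  fixes f g :: "('i \<Rightarrow> 'a) \<Rightarrow> real"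
  assumes "finite K" "finite J" "K \<inter> J = {}"
    and f: "has_bochner_integral (PiM K M) f a" and g: "has_bochner_integral (PiM J M) g b"
  shows "has_bochner_integral (PiM (K \<union> J) M) (\<lambda>x. f (restrict x K) * g (restrict x J)) (a * b)"
proof -
  interpret K: prob_space "PiM K M" by (intro prob_space_PiM M.prob_space_axioms)
  interpret J: prob_space "PiM J M" by (intro prob_space_PiM M.prob_space_axioms)
  interpret pair: pair_prob_space "PiM K M" "PiM J M" ..
  have [measurable]: "f \<in> borel_measurable (PiM K M)" "g \<in> borel_measurable (PiM J M)"
    using f g by (auto simp: has_bochner_integral_iff)
  have int: "integrable (PiM K M \<Otimes>\<^sub>M PiM J M) (\<lambda>z. f (fst z) * g (snd z))"
    using f g by (intro pair.Fubini_integrable) (auto simp: has_bochner_integral_iff abs_mult)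
  have val: "integral\<^sup>L (PiM K M \<Otimes>\<^sub>M PiM J M) (\<lambda>z. f (fst z) * g (snd z)) = a * b"
    using f g int by (subst pair.integral_fst'[symmetric]) (auto simp: has_bochner_integral_iff)
  have cong: "f (restrict (merge K J z) K) * g (restrict (merge K J z) J) = f (fst z) * g (snd z)"
    if "z \<in> space (PiM K M \<Otimes>\<^sub>M PiM J M)" for z
    using that assms(3) by (cases z) (auto simp: space_pair_measure space_PiM PiE_iff extensional_restrict)
  have "has_bochner_integral (PiM K M \<Otimes>\<^sub>M PiM J M)
      (\<lambda>z. f (restrict (merge K J z) K) * g (restrict (merge K J z) J)) (a * b)"
    using int val cong
    by (subst has_bochner_integral_cong[OF refl cong refl]) (auto simp: has_bochner_integral_iff)
  then have "has_bochner_integral (distr (PiM K M \<Otimes>\<^sub>M PiM J M) (PiM (K \<union> J) M) (merge K J))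
      (\<lambda>x. f (restrict x K) * g (restrict x J)) (a * b)"
    by (intro has_bochner_integral_distr) auto
  then show ?thesis
    by (simp only: distr_merge[OF assms(3,1,2)])
qed

text \<open>
  Both sides agree on boxes, where the integral of the product density factorises. This turns the
  law of a sample into a density with respect to another sample law.
\<close>

lemma PiM_density:
  fixes f :: "'i \<Rightarrow> 'a \<Rightarrow> real"
  assumes "finite I" and M: "product_sigma_finite M"
    and [measurable]: "\<And>i. f i \<in> borel_measurable (M i)" and nn: "\<And>i x. 0 \<le> f i x"
    and P: "\<And>i. prob_space (density (M i) (f i))"
  shows "PiM I (\<lambda>i. density (M i) (f i)) = density (PiM I M) (\<lambda>x. \<Prod>i\<in>I. f i (x i))"
proof -
  interpret M: product_sigma_finite M by fact
  interpret D: product_prob_space "\<lambda>i. density (M i) (f i)"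
    by (intro product_prob_spaceI P)
  show ?thesis
  proof (rule D.PiM_eqI[symmetric])
    show "sets (density (PiM I M) (\<lambda>x. \<Prod>i\<in>I. f i (x i))) = sets (PiM I (\<lambda>i. density (M i) (f i)))"
      by (auto intro!: sets_PiM_cong)
    fix A assume "\<And>i. i \<in> I \<Longrightarrow> A i \<in> sets (density (M i) (f i))"
    then have A[measurable]: "\<And>i. i \<in> I \<Longrightarrow> A i \<in> sets (M i)" by simp
    have "emeasure (density (PiM I M) (\<lambda>x. \<Prod>i\<in>I. f i (x i))) (PiE I A)
       = (\<integral>\<^sup>+x. (\<Prod>i\<in>I. ennreal (f i (x i))) * indicator (PiE I A) x \<partial>PiM I M)"
      using \<open>finite I\<close> A nn by (subst emeasure_density) (auto simp: prod_ennreal intro!: sets_PiM_I_finite)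
    also have "\<dots> = (\<integral>\<^sup>+x. (\<Prod>i\<in>I. ennreal (f i (x i)) * indicator (A i) (x i)) \<partial>PiM I M)"
      using \<open>finite I\<close>
      by (intro nn_integral_cong) (auto simp: prod.distrib space_PiM PiE_iff prod_zero_iff split: split_indicator)
    also have "\<dots> = (\<Prod>i\<in>I. emeasure (density (M i) (f i)) (A i))"
      using \<open>finite I\<close> by (subst M.product_nn_integral_prod) (auto simp: emeasure_density)
    finally show "emeasure (density (PiM I M) (\<lambda>x. \<Prod>i\<in>I. f i (x i))) (PiE I A)
       = (\<Prod>i\<in>I. emeasure (density (M i) (f i)) (A i))" .
  qed fact
qed

lemma (in prob_space) has_bochner_integral_Chebyshev:
  fixes T :: "'a \<Rightarrow> real"
  assumes T: "has_bochner_integral M T m" and T2: "has_bochner_integral M (\<lambda>x. T x * T x) v"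
    and "0 < t"
  shows "prob {x \<in> space M. t \<le> \<bar>T x - m\<bar>} \<le> (v - m\<^sup>2) / t\<^sup>2"
proof -
  have [simp]: "integrable M T" "integrable M (\<lambda>x. (T x)\<^sup>2)" and m: "expectation T = m"
    and v: "expectation (\<lambda>x. (T x)\<^sup>2) = v" and [measurable]: "random_variable borel T"
    using T T2 by (auto simp: has_bochner_integral_iff power2_eq_square)
  show ?thesis
    using Chebyshev_inequality[of T t] \<open>0 < t\<close> variance_eq[of T] by (simp add: m v)
qed

definition sample_mean :: "'i set \<Rightarrow> ('a \<Rightarrow> real) \<Rightarrow> ('i \<Rightarrow> 'a) \<Rightarrow> real" where
  "sample_mean I u X = (\<Sum>i\<in>I. u (X i)) / real (card I)"

lemma (in product_prob_space) has_bochner_integral_sample_mean: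
  assumes "finite I" "I \<noteq> {}" and "\<And>i. i \<in> I \<Longrightarrow> has_bochner_integral (M i) u a"
  shows "has_bochner_integral (PiM I M) (sample_mean I u) a"
proof -
  have "has_bochner_integral (PiM I M) (\<lambda>X. (\<Sum>i\<in>I. u (X i)) / real (card I)) ((\<Sum>i\<in>I. a) / real (card I))"
    using assms
    by (intro has_bochner_integral_divide has_bochner_integral_sum has_bochner_integral_PiM_component) auto
  then show ?thesis
    using assms by (simp add: sample_mean_def[abs_def])
qed

text \<open>
  Expanding the product gives \<open>card I\<close> diagonal pairs, with expectation \<open>c\<close>, and off-diagonal pairs of
  independent factors, with expectation \<open>a * b\<close>.
\<close>

lemma (in product_prob_space) has_bochner_integral_sample_mean_mult:
  assumes I: "finite I" "I \<noteq> {}"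
    and u: "\<And>i. i \<in> I \<Longrightarrow> has_bochner_integral (M i) u a"
    and v: "\<And>i. i \<in> I \<Longrightarrow> has_bochner_integral (M i) v b"
    and uv: "\<And>i. i \<in> I \<Longrightarrow> has_bochner_integral (M i) (\<lambda>x. u x * v x) c"
  shows "has_bochner_integral (PiM I M) (\<lambda>X. sample_mean I u X * sample_mean I v X)
           (a * b + (c - a * b) / real (card I))"
proof -
  let ?N = "real (card I)"
  have N: "?N \<noteq> 0" using I by simp
  have "has_bochner_integral (PiM I M) (\<lambda>X. u (X i) * v (X k)) (if i = k then c else a * b)"
    if "i \<in> I" "k \<in> I" for i k
    using that has_bochner_integral_PiM_component[OF I(1) that(1) uv[OF that(1)]]
      has_bochner_integral_PiM_two_components[OF I(1) that _ u v] by auto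
  then have "has_bochner_integral (PiM I M) (\<lambda>X. (\<Sum>i\<in>I. \<Sum>k\<in>I. u (X i) * v (X k)) / ?N\<^sup>2)
      ((\<Sum>i\<in>I. \<Sum>k\<in>I. if i = k then c else a * b) / ?N\<^sup>2)"
    by (intro has_bochner_integral_divide has_bochner_integral_sum) auto
  moreover have "(\<Sum>i\<in>I. \<Sum>k\<in>I. if i = k then c else a * b)
      = (\<Sum>i\<in>I. \<Sum>k\<in>I. a * b + (if i = k then c - a * b else 0))"
    by (intro sum.cong) auto
  moreover have "\<dots> = ?N\<^sup>2 * (a * b) + ?N * (c - a * b)"
    using I(1) by (simp add: sum.distrib power2_eq_square algebra_simps)
  ultimately show ?thesis
    using N by (simp add: sample_mean_def[abs_def] sum_product power2_eq_square add_divide_distrib)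
qed

section \<open>Gaussian laws and two-component mixtures\<close>

text \<open>
  Completing the square turns the exponentially tilted normal density into a shifted one.
\<close>

lemma has_bochner_integral_exp_normal_density:
  "has_bochner_integral lborel (\<lambda>x. normal_density m 1 x * exp (t * x)) (exp (t * m + t\<^sup>2 / 2))"
proof -
  have "normal_density m 1 x * exp (t * x) = exp (t * m + t\<^sup>2 / 2) * normal_density (m + t) 1 x" for x
  proof -
    have "- (x - m)\<^sup>2 / 2 + t * x = (t * m + t\<^sup>2 / 2) + - (x - (m + t))\<^sup>2 / 2"
      by (simp add: power2_eq_square field_simps)
    then show ?thesis
      by (simp add: normal_density_def exp_add[symmetric] mult.assoc)
  qed
  moreover have "has_bochner_integral lborel (\<lambda>x. exp (t * m + t\<^sup>2 / 2) * normal_density (m + t) 1 x)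
      (exp (t * m + t\<^sup>2 / 2) * 1)"
    by (intro has_bochner_integral_mult_right) (auto simp: has_bochner_integral_iff)
  ultimately show ?thesis by simp
qed

lemma has_bochner_integral_normal_density_square:
  "has_bochner_integral lborel (\<lambda>x. normal_density m 1 x * (x * x)) (1 + m\<^sup>2)"
proof -
  have "has_bochner_integral lborel
      (\<lambda>x. normal_density m 1 x * (x - m) ^ 2 + 2 * m * (normal_density m 1 x * x) - m\<^sup>2 * normal_density m 1 x)
      (1 + 2 * m * m - m\<^sup>2 * 1)"
    using normal_moment_even[of 1 m 1] normal_moment_nz_1[of 1 m]
    by (intro has_bochner_integral_diff has_bochner_integral_add has_bochner_integral_mult_right)
       (auto simp: has_bochner_integral_iff)
  moreover have "(\<lambda>x. normal_density m 1 x * (x - m) ^ 2 + 2 * m * (normal_density m 1 x * x) - m\<^sup>2 * normal_density m 1 x)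
     = (\<lambda>x. normal_density m 1 x * (x * x))"
    by (auto simp: power2_eq_square algebra_simps)
  moreover have "1 + 2 * m * m - m\<^sup>2 * 1 = 1 + m\<^sup>2"
    by (simp add: power2_eq_square)
  ultimately show ?thesis by (simp only:)
qed

definition gauss_law :: "nat \<Rightarrow> (nat \<Rightarrow> real) \<Rightarrow> (nat \<Rightarrow> real) measure" where
  "gauss_law d \<mu> = (\<Pi>\<^sub>M j\<in>{..<d}. density lborel (normal_density (\<mu> j) 1))"

lemma product_prob_space_normal:
  "product_prob_space (\<lambda>j. density lborel (normal_density (\<mu> j) 1))"
  by (intro product_prob_spaceI prob_space_normal_density) simp

lemma sets_gauss_law [simp, measurable_cong]: "sets (gauss_law d \<mu>) = sets (lebesgue_Rd d)"
  by (auto simp: gauss_law_def intro!: sets_PiM_cong)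

lemma prob_space_gauss_law: "prob_space (gauss_law d \<mu>)"
  unfolding gauss_law_def by (intro prob_space_PiM prob_space_normal_density) simp

lemma gauss_density_nonneg: "0 \<le> gauss_density d x"
  by (simp add: gauss_density_def prod_nonneg)

lemma measurable_gauss_density [measurable]: "gauss_density d \<in> borel_measurable (lebesgue_Rd d)"
  unfolding gauss_density_def[abs_def] by measurable

lemma measurable_shifted_gauss_density [measurable]:
  "(\<lambda>x. gauss_density d (\<lambda>j. x j - \<mu> j)) \<in> borel_measurable (lebesgue_Rd d)"
  unfolding gauss_density_def[abs_def] by measurable

lemma gauss_law_density:
  "gauss_law d \<mu> = density (lebesgue_Rd d) (\<lambda>x. gauss_density d (\<lambda>j. x j - \<mu> j))"
proof -
  have "gauss_law d \<mu> = density (lebesgue_Rd d) (\<lambda>x. \<Prod>j<d. normal_density (\<mu> j) 1 (x j))"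
    unfolding gauss_law_def
    by (intro PiM_density prob_space_normal_density product_sigma_finite.intro
        lborel.sigma_finite_measure_axioms) auto
  then show ?thesis
    by (simp add: gauss_density_def normal_density_def)
qed

lemma has_bochner_integral_gauss_law_coord:
  assumes "j < d" "has_bochner_integral lborel (\<lambda>x. normal_density (\<mu> j) 1 x * f x) c"
    and "f \<in> borel_measurable borel"
  shows "has_bochner_integral (gauss_law d \<mu>) (\<lambda>x. f (x j)) c"
proof -
  interpret product_prob_space "\<lambda>j. density lborel (normal_density (\<mu> j) 1)" "{..<d}"
    by (rule product_prob_space_normal)
  show ?thesis
    unfolding gauss_law_def using assms
    by (intro has_bochner_integral_PiM_component has_bochner_integral_density) auto
qed

lemma has_bochner_integral_gauss_law_first_moment:
  "j < d \<Longrightarrow> has_bochner_integral (gauss_law d \<mu>) (\<lambda>x. x j) (\<mu> j)"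
  using has_bochner_integral_gauss_law_coord[of j d \<mu> "\<lambda>x. x"] normal_moment_nz_1[of 1 "\<mu> j"] by simp

lemma has_bochner_integral_gauss_law_second_moment:
  assumes "j < d" "l < d"
  shows "has_bochner_integral (gauss_law d \<mu>) (\<lambda>x. x j * x l) ((if j = l then 1 else 0) + \<mu> j * \<mu> l)"
proof (cases "j = l")
  case True
  then show ?thesis
    using has_bochner_integral_gauss_law_coord[of j d \<mu> "\<lambda>x. x * x"] assms
      has_bochner_integral_normal_density_square[of "\<mu> j"] by (simp add: power2_eq_square)
next
  case False
  interpret product_prob_space "\<lambda>j. density lborel (normal_density (\<mu> j) 1)" "{..<d}"
    by (rule product_prob_space_normal)
  have "has_bochner_integral (density lborel (normal_density (\<mu> j) 1)) (\<lambda>x. x) (\<mu> j)" for j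
    using normal_moment_nz_1[of 1 "\<mu> j"] by (intro has_bochner_integral_density) auto
  then have "has_bochner_integral (gauss_law d \<mu>) (\<lambda>x. x j * x l) (\<mu> j * \<mu> l)"
    unfolding gauss_law_def using assms False
    by (intro has_bochner_integral_PiM_two_components) auto
  then show ?thesis using False by simp
qed

lemma has_bochner_integral_gauss_law_exp:
  "has_bochner_integral (gauss_law d (\<lambda>_. 0)) (\<lambda>x. exp (\<Sum>j<d. a j * x j)) (exp (\<Sum>j<d. (a j)\<^sup>2 / 2))"
proof -
  interpret product_prob_space "\<lambda>j::nat. density lborel std_normal_density" "{..<d}"
    using product_prob_space_normal[of "\<lambda>_. 0"] by simp
  show ?thesis
    unfolding gauss_law_def exp_sum[OF finite_lessThan]
    using has_bochner_integral_exp_normal_density[of 0]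
    by (intro has_bochner_integral_PiM_prod has_bochner_integral_density) auto
qed

definition mixture_law :: "nat \<Rightarrow> real \<Rightarrow> (nat \<Rightarrow> real) \<Rightarrow> (nat \<Rightarrow> real) measure" where
  "mixture_law d \<epsilon> \<mu> = density (lebesgue_Rd d) (mixture_density d \<epsilon> \<mu>)"

lemma sets_mixture_law [simp, measurable_cong]: "sets (mixture_law d \<epsilon> \<mu>) = sets (lebesgue_Rd d)"
  by (simp add: mixture_law_def)

lemma measurable_mixture_density [measurable]:
  "mixture_density d \<epsilon> \<mu> \<in> borel_measurable (lebesgue_Rd d)"
  unfolding mixture_density_def[abs_def] by measurable

lemma mixture_density_nonneg: "0 \<le> \<epsilon> \<Longrightarrow> \<epsilon> \<le> 1 \<Longrightarrow> 0 \<le> mixture_density d \<epsilon> \<mu> x"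
  by (simp add: mixture_density_def gauss_density_nonneg)

text \<open>
  Expectations under the mixture are convex combinations of Gaussian expectations; all moments of
  the observations are computed in this way.
\<close>

lemma has_bochner_integral_mixture_law:
  fixes f :: "(nat \<Rightarrow> real) \<Rightarrow> real"
  assumes "0 \<le> \<epsilon>" "\<epsilon> \<le> 1"
    and a: "has_bochner_integral (gauss_law d (\<lambda>_. 0)) f a"
    and b: "has_bochner_integral (gauss_law d \<mu>) f b"
  shows "has_bochner_integral (mixture_law d \<epsilon> \<mu>) f ((1 - \<epsilon>) * a + \<epsilon> * b)"
proof -
  have *: "has_bochner_integral (lebesgue_Rd d) (\<lambda>x. gauss_density d (\<lambda>j. x j - \<nu> j) * f x) c"
    if c: "has_bochner_integral (gauss_law d \<nu>) f c" for \<nu> c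
  proof -
    have f: "f \<in> borel_measurable (lebesgue_Rd d)"
      using borel_measurable_has_bochner_integral[OF c] by simp
    show ?thesis
      using c unfolding gauss_law_density has_bochner_integral_iff
      by (simp add: integrable_real_density[OF measurable_shifted_gauss_density _ f]
          integral_real_density[OF measurable_shifted_gauss_density _ f] gauss_density_nonneg)
  qed
  have [measurable]: "f \<in> borel_measurable (lebesgue_Rd d)"
    using a by (auto simp: has_bochner_integral_iff)
  have "has_bochner_integral (lebesgue_Rd d)
     (\<lambda>x. (1 - \<epsilon>) * (gauss_density d (\<lambda>j. x j - 0) * f x) + \<epsilon> * (gauss_density d (\<lambda>j. x j - \<mu> j) * f x))
     ((1 - \<epsilon>) * a + \<epsilon> * b)"
    by (intro has_bochner_integral_add has_bochner_integral_mult_right * a b)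
  then show ?thesis
    unfolding mixture_law_def using assms(1,2)
    by (intro has_bochner_integral_density)
       (simp_all add: mixture_density_nonneg, simp add: mixture_density_def algebra_simps)
qed

lemma prob_space_mixture_law:
  assumes "0 \<le> \<epsilon>" "\<epsilon> \<le> 1"
  shows "prob_space (mixture_law d \<epsilon> \<mu>)"
proof -
  have "has_bochner_integral (gauss_law d \<nu>) (\<lambda>_. 1::real) 1" for \<nu>
    by (simp add: has_bochner_integral_iff prob_space.prob_space prob_space_gauss_law
        prob_space.finite_measure finite_measure.integrable_const)
  from has_bochner_integral_mixture_law[OF assms this this]
  have "has_bochner_integral (mixture_law d \<epsilon> \<mu>) (\<lambda>_. 1::real) 1" by simp
  then have "measure (mixture_law d \<epsilon> \<mu>) (space (mixture_law d \<epsilon> \<mu>)) = 1"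
    by (simp add: has_bochner_integral_iff)
  moreover from this have "emeasure (mixture_law d \<epsilon> \<mu>) (space (mixture_law d \<epsilon> \<mu>)) \<noteq> \<infinity>"
    by (auto simp: measure_def)
  ultimately show ?thesis
    by (intro prob_spaceI) (simp add: emeasure_eq_ennreal_measure)
qed

lemma has_bochner_integral_mixture_law_first_moment:
  assumes "0 \<le> \<epsilon>" "\<epsilon> \<le> 1" "j < d"
  shows "has_bochner_integral (mixture_law d \<epsilon> \<mu>) (\<lambda>x. x j) (\<epsilon> * \<mu> j)"
  using has_bochner_integral_mixture_law[OF assms(1,2)
      has_bochner_integral_gauss_law_first_moment has_bochner_integral_gauss_law_first_moment, of j d] assms
  by simp

lemma has_bochner_integral_mixture_law_second_moment:
  assumes "0 \<le> \<epsilon>" "\<epsilon> \<le> 1" "j < d" "l < d"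
  shows "has_bochner_integral (mixture_law d \<epsilon> \<mu>) (\<lambda>x. x j * x l)
           ((if j = l then 1 else 0) + \<epsilon> * \<mu> j * \<mu> l)"
proof -
  have "has_bochner_integral (mixture_law d \<epsilon> \<mu>) (\<lambda>x. x j * x l)
     ((1 - \<epsilon>) * ((if j = l then 1 else 0) + 0 * 0) + \<epsilon> * ((if j = l then 1 else 0) + \<mu> j * \<mu> l))"
    by (intro has_bochner_integral_mixture_law has_bochner_integral_gauss_law_second_moment assms)
  also have "(1 - \<epsilon>) * ((if j = l then 1 else 0) + 0 * 0) + \<epsilon> * ((if j = l then 1 else 0) + \<mu> j * \<mu> l)
     = (if j = l then 1 else 0) + \<epsilon> * \<mu> j * \<mu> l"
    by (auto simp: algebra_simps)
  finally show ?thesis .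
qed

text \<open>
  The null hypothesis is the mixture with weight \<open>0\<close>, so that statements about mixtures cover both
  hypotheses.
\<close>

lemma gauss_density_eq_mixture: "gauss_density d = mixture_density d 0 \<mu>"
  by (auto simp: mixture_density_def)

lemma sample_law_eq: "sample_law n d (mixture_density d \<epsilon> \<mu>) = PiM {..<n} (\<lambda>_. mixture_law d \<epsilon> \<mu>)"
  by (simp add: sample_law_def mixture_law_def)

lemma sets_sample_law [simp, measurable_cong]:
  "sets (sample_law n d g) = sets (\<Pi>\<^sub>M i\<in>{..<n}. lebesgue_Rd d)"
  by (auto simp: sample_law_def intro!: sets_PiM_cong)

lemma space_sample_law [simp]:
  "space (sample_law n d g) = space (\<Pi>\<^sub>M i\<in>{..<n}. lebesgue_Rd d)"
  by (rule sets_eq_imp_space_eq) simp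

lemma product_prob_space_mixture:
  "0 \<le> \<epsilon> \<Longrightarrow> \<epsilon> \<le> 1 \<Longrightarrow> product_prob_space (\<lambda>_. mixture_law d \<epsilon> \<mu>)"
  by (intro product_prob_spaceI prob_space_mixture_law)

lemma prob_space_sample_law:
  "0 \<le> \<epsilon> \<Longrightarrow> \<epsilon> \<le> 1 \<Longrightarrow> prob_space (sample_law n d (mixture_density d \<epsilon> \<mu>))"
  by (simp add: sample_law_eq prob_space_PiM prob_space_mixture_law)

section \<open>Moments of the sample means and of the split statistic\<close>

lemma sample_mean_restrict:
  "I \<subseteq> J \<Longrightarrow> sample_mean I u (restrict X J) = sample_mean I u X"
  unfolding sample_mean_def by (intro arg_cong2[where f="(/)"] sum.cong) (auto simp: subset_eq)

lemma has_bochner_integral_mixture_mean: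
  assumes "0 \<le> \<epsilon>" "\<epsilon> \<le> 1" "j < d" and I: "finite I" "I \<noteq> {}"
  shows "has_bochner_integral (PiM I (\<lambda>_. mixture_law d \<epsilon> \<mu>)) (sample_mean I (\<lambda>x. x j)) (\<epsilon> * \<mu> j)"
proof -
  interpret product_prob_space "\<lambda>_. mixture_law d \<epsilon> \<mu>" I
    by (rule product_prob_space_mixture) fact+
  show ?thesis
    by (intro has_bochner_integral_sample_mean I has_bochner_integral_mixture_law_first_moment assms)
qed

lemma has_bochner_integral_mixture_mean_mult:
  assumes "0 \<le> \<epsilon>" "\<epsilon> \<le> 1" "j < d" "l < d" and I: "finite I" "I \<noteq> {}"
  shows "has_bochner_integral (PiM I (\<lambda>_. mixture_law d \<epsilon> \<mu>))
     (\<lambda>X. sample_mean I (\<lambda>x. x j) X * sample_mean I (\<lambda>x. x l) X)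
     ((\<epsilon>\<^sup>2 + \<epsilon> * (1 - \<epsilon>) / card I) * (\<mu> j * \<mu> l) + (if j = l then 1 / card I else 0))"
proof -
  interpret product_prob_space "\<lambda>_. mixture_law d \<epsilon> \<mu>" I
    by (rule product_prob_space_mixture) fact+
  have "has_bochner_integral (PiM I (\<lambda>_. mixture_law d \<epsilon> \<mu>))
     (\<lambda>X. sample_mean I (\<lambda>x. x j) X * sample_mean I (\<lambda>x. x l) X)
     (\<epsilon> * \<mu> j * (\<epsilon> * \<mu> l) + ((if j = l then 1 else 0) + \<epsilon> * \<mu> j * \<mu> l - \<epsilon> * \<mu> j * (\<epsilon> * \<mu> l)) / card I)"
    by (intro has_bochner_integral_sample_mean_mult I has_bochner_integral_mixture_law_first_moment
        has_bochner_integral_mixture_law_second_moment assms)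
  also have "\<epsilon> * \<mu> j * (\<epsilon> * \<mu> l) + ((if j = l then 1 else 0) + \<epsilon> * \<mu> j * \<mu> l - \<epsilon> * \<mu> j * (\<epsilon> * \<mu> l)) / card I
    = (\<epsilon>\<^sup>2 + \<epsilon> * (1 - \<epsilon>) / card I) * (\<mu> j * \<mu> l) + (if j = l then 1 / card I else 0)"
    by (simp add: power2_eq_square algebra_simps add_divide_distrib diff_divide_distrib)
  finally show ?thesis .
qed

lemma measurable_sample_mean_coord [measurable]:
  assumes "I \<subseteq> {..<n}" "j < d"
  shows "sample_mean I (\<lambda>x. x j) \<in> borel_measurable (\<Pi>\<^sub>M i\<in>{..<n}. lebesgue_Rd d)"
  unfolding sample_mean_def[abs_def]
proof (intro borel_measurable_divide borel_measurable_sum borel_measurable_const)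
  fix i assume "i \<in> I"
  with assms show "(\<lambda>X. X i j) \<in> borel_measurable (\<Pi>\<^sub>M i\<in>{..<n}. lebesgue_Rd d)"
    using measurable_compose[OF measurable_component_singleton[of i "{..<n}" "\<lambda>_. lebesgue_Rd d"]
        measurable_component_singleton[of j "{..<d}" "\<lambda>_. lborel"]] by auto
qed

text \<open>
  An estimate of \<open>\<epsilon>\<^sup>2 * \<parallel>\<mu>\<parallel>\<^sup>2\<close> without bias: pairing two independent halves of the sample avoids the
  diagonal terms that bias the squared norm of the full mean.
\<close>

definition split_statistic :: "nat \<Rightarrow> nat \<Rightarrow> nat \<Rightarrow> (nat \<Rightarrow> nat \<Rightarrow> real) \<Rightarrow> real" where
  "split_statistic m n d X =
     (\<Sum>j<d. sample_mean {..<m} (\<lambda>x. x j) X * sample_mean {m..<n} (\<lambda>x. x j) X)"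

lemma measurable_split_statistic [measurable]:
  "m \<le> n \<Longrightarrow> split_statistic m n d \<in> borel_measurable (\<Pi>\<^sub>M i\<in>{..<n}. lebesgue_Rd d)"
  unfolding split_statistic_def[abs_def]
  by (intro borel_measurable_sum borel_measurable_times measurable_sample_mean_coord) auto

text \<open>
  Each half contributes a matrix \<open>a \<mu> \<mu>\<^sup>T + p I\<close> of second moments of its mean vector; the second
  moment of the split statistic is the entrywise inner product of the two matrices.
\<close>

lemma sum_prod_diagonal:
  fixes \<mu> :: "nat \<Rightarrow> real"
  shows "(\<Sum>j<d. \<Sum>l<d. (a * (\<mu> j * \<mu> l) + (if j = l then p else 0)) * (b * (\<mu> j * \<mu> l) + (if j = l then q else 0)))
    = a * b * (\<Sum>j<d. (\<mu> j)\<^sup>2)\<^sup>2 + (a * q + b * p) * (\<Sum>j<d. (\<mu> j)\<^sup>2) + p * q * d"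
proof -
  have "(\<Sum>j<d. \<Sum>l<d. (a * (\<mu> j * \<mu> l) + (if j = l then p else 0)) * (b * (\<mu> j * \<mu> l) + (if j = l then q else 0)))
    = (\<Sum>j<d. \<Sum>l<d. a * b * ((\<mu> j)\<^sup>2 * (\<mu> l)\<^sup>2) + (if j = l then (a * q + b * p) * (\<mu> j)\<^sup>2 + p * q else 0))"
    by (intro sum.cong) (auto simp: power2_eq_square algebra_simps)
  also have "\<dots> = a * b * (\<Sum>j<d. (\<mu> j)\<^sup>2)\<^sup>2 + (a * q + b * p) * (\<Sum>j<d. (\<mu> j)\<^sup>2) + p * q * d"
    by (simp add: sum.distrib sum_distrib_left[symmetric] sum_product power2_eq_square[of "sum _ _"])
  finally show ?thesis .
qed

lemma has_bochner_integral_split_statistic: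
  fixes d :: nat and \<mu> :: "nat \<Rightarrow> real" and \<epsilon> :: real
  assumes \<epsilon>: "0 \<le> \<epsilon>" "\<epsilon> \<le> 1" and m: "0 < m" "m < n"
  defines "R \<equiv> \<Sum>j<d. (\<mu> j)\<^sup>2"
    and "a \<equiv> \<epsilon>\<^sup>2 + \<epsilon> * (1 - \<epsilon>) / real m" and "b \<equiv> \<epsilon>\<^sup>2 + \<epsilon> * (1 - \<epsilon>) / real (n - m)"
  shows "has_bochner_integral (sample_law n d (mixture_density d \<epsilon> \<mu>)) (split_statistic m n d) (\<epsilon>\<^sup>2 * R)"
    and "has_bochner_integral (sample_law n d (mixture_density d \<epsilon> \<mu>))
      (\<lambda>X. split_statistic m n d X * split_statistic m n d X)
      (a * b * R\<^sup>2 + (a / real (n - m) + b / real m) * R + d / (real m * real (n - m)))"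
proof -
  interpret product_prob_space "\<lambda>_. mixture_law d \<epsilon> \<mu>" "{..<n}"
    by (rule product_prob_space_mixture) fact+
  have un: "{..<m} \<union> {m..<n} = {..<n}" using m by auto
  note blocks = has_bochner_integral_PiM_disjoint_blocks[of "{..<m}" "{m..<n}", unfolded un]
  have ne: "{..<m} \<noteq> {}" "{m..<n} \<noteq> {}" using m by auto
  have "has_bochner_integral (PiM {..<n} (\<lambda>_. mixture_law d \<epsilon> \<mu>)) (split_statistic m n d)
     (\<Sum>j<d. (\<epsilon> * \<mu> j) * (\<epsilon> * \<mu> j))"
    unfolding split_statistic_def[abs_def]
  proof (intro has_bochner_integral_sum)
    fix j assume "j \<in> {..<d}"
    then show "has_bochner_integral (PiM {..<n} (\<lambda>_. mixture_law d \<epsilon> \<mu>))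
       (\<lambda>X. sample_mean {..<m} (\<lambda>x. x j) X * sample_mean {m..<n} (\<lambda>x. x j) X) (\<epsilon> * \<mu> j * (\<epsilon> * \<mu> j))"
      using blocks[OF _ _ _ has_bochner_integral_mixture_mean has_bochner_integral_mixture_mean,
          OF _ _ _ \<epsilon> _ _ ne(1) \<epsilon> _ _ ne(2), of j j]
      by (simp add: sample_mean_restrict ivl_disj_int)
  qed
  then show "has_bochner_integral (sample_law n d (mixture_density d \<epsilon> \<mu>)) (split_statistic m n d) (\<epsilon>\<^sup>2 * R)"
    by (simp add: sample_law_eq R_def sum_distrib_left power2_eq_square algebra_simps)
  let ?A = "\<lambda>j. sample_mean {..<m} (\<lambda>x. x j)" and ?B = "\<lambda>j. sample_mean {m..<n} (\<lambda>x. x j)"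
  have "has_bochner_integral (PiM {..<n} (\<lambda>_. mixture_law d \<epsilon> \<mu>))
     (\<lambda>X. \<Sum>j<d. \<Sum>l<d. (?A j X * ?A l X) * (?B j X * ?B l X))
     (\<Sum>j<d. \<Sum>l<d. (a * (\<mu> j * \<mu> l) + (if j = l then 1 / real m else 0))
        * (b * (\<mu> j * \<mu> l) + (if j = l then 1 / real (n - m) else 0)))"
  proof (intro has_bochner_integral_sum)
    fix j l assume "j \<in> {..<d}" "l \<in> {..<d}"
    then show "has_bochner_integral (PiM {..<n} (\<lambda>_. mixture_law d \<epsilon> \<mu>))
       (\<lambda>X. (?A j X * ?A l X) * (?B j X * ?B l X))
       ((a * (\<mu> j * \<mu> l) + (if j = l then 1 / real m else 0))
        * (b * (\<mu> j * \<mu> l) + (if j = l then 1 / real (n - m) else 0)))"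
      using blocks[OF _ _ _ has_bochner_integral_mixture_mean_mult has_bochner_integral_mixture_mean_mult,
          OF _ _ _ \<epsilon> _ _ _ ne(1) \<epsilon> _ _ _ ne(2), of j l j l]
      by (simp add: sample_mean_restrict ivl_disj_int a_def b_def cong: if_cong)
  qed
  then show "has_bochner_integral (sample_law n d (mixture_density d \<epsilon> \<mu>))
      (\<lambda>X. split_statistic m n d X * split_statistic m n d X)
      (a * b * R\<^sup>2 + (a / real (n - m) + b / real m) * R + d / (real m * real (n - m)))"
    unfolding sum_prod_diagonal R_def[symmetric] sample_law_eq
    by (simp add: split_statistic_def[abs_def] sum_product algebra_simps)
qed

text \<open>
  Here \<open>p\<close> and \<open>q\<close> are the inverse sizes of the two halves, \<open>R\<close> is the squared norm of \<open>\<mu>\<close> and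
  \<open>\<epsilon>\<^sup>2 * R\<close> the mean of the split statistic. The terms \<open>\<epsilon>\<^sup>4 R\<^sup>2\<close> cancel in the variance, and every
  remaining term carries a factor \<open>p\<close> or \<open>q\<close>.
\<close>

lemma split_variance_bound:
  fixes \<epsilon> R L p q Q d :: real
  assumes "0 \<le> \<epsilon>" "\<epsilon> \<le> 1" "0 \<le> R" "R \<le> L" "0 \<le> p" "p \<le> Q" "0 \<le> q" "q \<le> Q" "1 \<le> d"
  defines "a \<equiv> \<epsilon>\<^sup>2 + \<epsilon> * (1 - \<epsilon>) * p" and "b \<equiv> \<epsilon>\<^sup>2 + \<epsilon> * (1 - \<epsilon>) * q"
  shows "a * b * R\<^sup>2 + (a * q + b * p) * R + d * (p * q) - (\<epsilon>\<^sup>2 * R)\<^sup>2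
     \<le> Q\<^sup>2 * d * (1 + L)\<^sup>2 + 2 * Q * (\<epsilon>\<^sup>2 * R) * (1 + L)"
proof -
  define k where "k = \<epsilon> * (1 - \<epsilon>)"
  have k: "0 \<le> k" "k \<le> 1" using assms(1,2) by (auto simp: k_def intro: mult_le_one)
  have pq: "p * q \<le> Q\<^sup>2" using assms by (auto simp: power2_eq_square intro!: mult_mono)
  have kR: "0 \<le> k * R" "k * R \<le> L" using k assms mult_mono[of k 1 R L] by auto
  have Q: "0 \<le> Q" using assms by linarith
  have "a * b * R\<^sup>2 + (a * q + b * p) * R + d * (p * q) - (\<epsilon>\<^sup>2 * R)\<^sup>2
    = (p * q) * (d + 2 * (k * R) + (k * R)\<^sup>2) + (p + q) * ((\<epsilon>\<^sup>2 * R) * (1 + k * R))"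
    unfolding a_def b_def k_def[symmetric] by (simp add: power2_eq_square algebra_simps)
  also have "\<dots> \<le> Q\<^sup>2 * (d * (1 + L)\<^sup>2) + (Q + Q) * ((\<epsilon>\<^sup>2 * R) * (1 + L))"
  proof (intro add_mono mult_mono)
    have "(k * R)\<^sup>2 \<le> L\<^sup>2" using kR by (intro power_mono)
    moreover have "2 * L + L\<^sup>2 \<le> d * (2 * L + L\<^sup>2)"
      using assms kR by (intro mult_right_mono[of 1 d, simplified]) auto
    ultimately show "d + 2 * (k * R) + (k * R)\<^sup>2 \<le> d * (1 + L)\<^sup>2"
      using kR(2) by (simp add: power2_eq_square algebra_simps)
  qed (use assms kR pq Q in auto)
  also have "\<dots> = Q\<^sup>2 * d * (1 + L)\<^sup>2 + 2 * Q * (\<epsilon>\<^sup>2 * R) * (1 + L)"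
    by (simp add: algebra_simps)
  finally show ?thesis .
qed

text \<open>
  Taking \<open>\<epsilon> = 0\<close>, \<open>\<mu> = 0\<close> and \<open>L = 0\<close> gives the bound \<open>Q\<^sup>2 * d / t\<^sup>2\<close> under the null hypothesis.
\<close>

lemma split_statistic_Chebyshev:
  fixes d :: nat
  assumes \<epsilon>: "0 \<le> \<epsilon>" "\<epsilon> \<le> 1" and m: "0 < m" "m < n" and "1 \<le> d"
    and Q: "1 / real m \<le> Q" "1 / real (n - m) \<le> Q" and "0 < t"
    and R: "R = (\<Sum>j<d. (\<mu> j)\<^sup>2)" "R \<le> L"
  shows "measure (sample_law n d (mixture_density d \<epsilon> \<mu>))
      {X \<in> space (sample_law n d (mixture_density d \<epsilon> \<mu>)). t \<le> \<bar>split_statistic m n d X - \<epsilon>\<^sup>2 * R\<bar>}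
     \<le> (Q\<^sup>2 * d * (1 + L)\<^sup>2 + 2 * Q * (\<epsilon>\<^sup>2 * R) * (1 + L)) / t\<^sup>2"
proof -
  interpret prob_space "sample_law n d (mixture_density d \<epsilon> \<mu>)"
    by (rule prob_space_sample_law) fact+
  have "0 \<le> R" by (simp add: R sum_nonneg)
  note order_trans[OF has_bochner_integral_Chebyshev[OF
    has_bochner_integral_split_statistic[OF \<epsilon> m, of d \<mu>, folded R(1)] \<open>0 < t\<close>] divide_right_mono]
  from this[OF split_variance_bound[OF \<epsilon> \<open>0 \<le> R\<close> R(2), of "1 / real m" Q "1 / real (n - m)" "real d", simplified]]
  show ?thesis using Q \<open>1 \<le> d\<close> by simp
qed

lemma indicator_test:
  assumes [measurable]: "Measurable.pred (\<Pi>\<^sub>M i\<in>{..<n}. lebesgue_Rd d) P"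
  defines "\<Psi> \<equiv> \<lambda>X. if P X then 1 else (0::nat)"
  shows "\<Psi> \<in> tests n d"
    and "test_prob n d g \<Psi> 1 = emeasure (sample_law n d g) {X \<in> space (sample_law n d g). P X}"
    and "test_prob n d g \<Psi> 0 = emeasure (sample_law n d g) {X \<in> space (sample_law n d g). \<not> P X}"
proof -
  show "\<Psi> \<in> tests n d" unfolding tests_def \<Psi>_def by measurable
qed (auto simp: test_prob_def \<Psi>_def intro!: arg_cong[where f="emeasure _"])

lemma ex_level_test_if_empty:
  assumes "0 \<le> \<alpha>" "A = {}"
  shows "\<exists>\<Psi>\<in>level_tests n d \<alpha>. worst_error n d A \<Psi> \<le> ennreal \<beta>"
proof
  show "(\<lambda>X. 0) \<in> level_tests n d \<alpha>"
    by (simp add: level_tests_def tests_def test_prob_def)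
  show "worst_error n d A (\<lambda>X. 0) \<le> ennreal \<beta>" by (simp add: worst_error_def assms)
qed

section \<open>A test for the Euclidean norm\<close>

lemma norm2_power2: "(norm2 d \<mu>)\<^sup>2 = (\<Sum>j<d. (\<mu> j)\<^sup>2)"
  by (simp add: norm2_def L2_set_def sum_nonneg)

lemma norm2_nonneg: "0 \<le> norm2 d \<mu>"
  by (simp add: norm2_def)

lemma separated_classD:
  assumes "(\<epsilon>, \<mu>) \<in> separated_class N d M \<rho>"
  shows "0 < \<epsilon>" "\<epsilon> < 1" "N d \<mu> \<le> M" "\<rho> < \<epsilon> * N d \<mu>"
  using assms by (auto simp: separated_class_def mixture_class_def)

lemma worst_error_le:
  assumes "\<And>\<epsilon> \<mu>. (\<epsilon>, \<mu>) \<in> A \<Longrightarrow> test_prob n d (mixture_density d \<epsilon> \<mu>) \<Psi> 0 \<le> ennreal \<beta>"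
  shows "worst_error n d A \<Psi> \<le> ennreal \<beta>"
  unfolding worst_error_def using assms by (auto intro!: SUP_least)

text \<open>
  Here \<open>w\<close> stands for \<open>sqrt d\<close>, \<open>s2\<close> for the mean \<open>\<epsilon>\<^sup>2 * \<parallel>\<mu>\<parallel>\<^sup>2\<close> of the split statistic, \<open>L\<close> for \<open>1 + M\<^sup>2\<close>
  and \<open>x\<close> for a third of the squared separation constant. With \<open>y = L / x\<close> the Chebyshev bound is at
  most \<open>4 * y\<^sup>2 + 8 * y\<close>.
\<close>

lemma l2_error_arithmetic:
  fixes Q w L x s2 \<beta> :: real
  assumes "0 < Q" "1 \<le> w" "1 \<le> L" "0 < \<beta>" "\<beta> \<le> 1" "12 * L / \<beta> \<le> x" "Q * w * x \<le> s2"
  shows "(Q\<^sup>2 * w\<^sup>2 * L\<^sup>2 + 2 * Q * s2 * L) / (s2 / 2)\<^sup>2 \<le> \<beta>"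
proof -
  have "1 \<le> 12 * L / \<beta>" using assms by (simp add: field_simps)
  then have x: "1 \<le> x" using assms by linarith
  have Qwx: "0 < Q * w * x" using assms x by auto
  then have s: "0 < s2" using assms by linarith
  define y where "y = L / x"
  have y: "0 \<le> y" "12 * y \<le> \<beta>"
    using assms x by (auto simp: y_def field_simps)
  then have "y \<le> 1" using assms by linarith
  have u: "Q * w * L / s2 \<le> y"
  proof -
    have "Q * w * L * x \<le> L * s2" using assms mult_left_mono[OF assms(7), of L] by (simp add: mult_ac)
    then show ?thesis using x s by (simp add: y_def divide_simps)
  qed
  have v: "Q * L / s2 \<le> y"
  proof (rule order_trans[OF _ u])
    have "Q * L * 1 \<le> Q * L * w" using assms by (intro mult_left_mono) auto
    then show "Q * L / s2 \<le> Q * w * L / s2" using s by (intro divide_right_mono) (auto simp: ac_simps)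
  qed
  have "(Q\<^sup>2 * w\<^sup>2 * L\<^sup>2 + 2 * Q * s2 * L) / (s2 / 2)\<^sup>2
      = 4 * (Q * w * L / s2)\<^sup>2 + 8 * (Q * L / s2)"
    using s by (simp add: field_simps power2_eq_square)
  also have "\<dots> \<le> 4 * y\<^sup>2 + 8 * y"
    using u v assms s by (intro add_mono mult_left_mono power_mono) auto
  also have "\<dots> \<le> 4 * y + 8 * y"
    using y \<open>y \<le> 1\<close> mult_left_le[of y y] by (simp add: power2_eq_square)
  finally show ?thesis using y by simp
qed

text \<open>
  For \<open>n = 1\<close> there are no two halves, but then \<open>M \<le> C\<close> makes the alternative empty. For \<open>n \<ge> 2\<close> each
  half has at least \<open>n / 3\<close> observations, which is the reason for \<open>Q = 3 / n\<close>. The threshold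
  \<open>Q * sqrt d / sqrt \<alpha>\<close> makes the Chebyshev bound under the null hypothesis equal to \<open>\<alpha>\<close>, and the third
  condition on \<open>C\<close> places it at or below half the mean of the statistic under the alternative.
\<close>

lemma l2_upper_bound:
  fixes M \<alpha> \<beta> C :: real and n d :: nat
  assumes "0 < M" "0 < \<alpha>" "0 < \<beta>" "\<beta> \<le> 1" and n: "1 \<le> n" and d: "1 \<le> d"
    and C: "M \<le> C" "36 * (1 + M\<^sup>2) / \<beta> \<le> C\<^sup>2" "6 / sqrt \<alpha> \<le> C\<^sup>2"
  shows "\<exists>\<Psi>\<in>level_tests n d \<alpha>.
    worst_error n d (separated_class norm2 d M (C * real d powr (1/4) / sqrt (real n))) \<Psi> \<le> ennreal \<beta>"
proof (cases "n = 1")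
  case True
  have "1 \<le> real d powr (1/4)" using d by (intro ge_one_powr_ge_zero) auto
  then have "M * 1 \<le> C * real d powr (1/4)" using C \<open>0 < M\<close> by (intro mult_mono) auto
  moreover have "\<epsilon> * norm2 d \<mu> \<le> 1 * M" if "0 < \<epsilon>" "\<epsilon> < 1" "norm2 d \<mu> \<le> M" for \<epsilon> \<mu>
    using that norm2_nonneg[of d \<mu>] by (intro mult_mono) auto
  ultimately have "separated_class norm2 d M (C * real d powr (1/4) / sqrt (real n)) = {}"
    using True by (force dest: separated_classD)
  then show ?thesis using \<open>0 < \<alpha>\<close> by (intro ex_level_test_if_empty) auto
next
  case False
  define m where "m = n div 2"
  have m: "0 < m" "m < n" using False n by (auto simp: m_def)
  define Q where "Q = 3 / real n"
  have "0 < Q" using n by (simp add: Q_def)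
  have Q: "1 / real m \<le> Q" "1 / real (n - m) \<le> Q"
  proof -
    have "n \<le> 3 * m" "n \<le> 3 * (n - m)" using False n unfolding m_def by linarith+
    then have "real n \<le> 3 * real m" "real n \<le> 3 * real (n - m)" by linarith+
    then show "1 / real m \<le> Q" "1 / real (n - m) \<le> Q" using m by (auto simp: Q_def field_simps)
  qed
  define w where "w = sqrt (real d)"
  have w: "1 \<le> w" "w\<^sup>2 = real d" using d by (auto simp: w_def)
  define t where "t = Q * w / sqrt \<alpha>"
  have "0 < t" using \<open>0 < Q\<close> w \<open>0 < \<alpha>\<close> by (auto simp: t_def)
  define P where "P X \<longleftrightarrow> t \<le> \<bar>split_statistic m n d X\<bar>" for X
  define \<Psi> where "\<Psi> = (\<lambda>X. if P X then 1 else (0::nat))"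
  have [measurable]: "split_statistic m n d \<in> borel_measurable (\<Pi>\<^sub>M i\<in>{..<n}. lebesgue_Rd d)"
    using m by (intro measurable_split_statistic) simp
  have [measurable]: "Measurable.pred (\<Pi>\<^sub>M i\<in>{..<n}. lebesgue_Rd d) P"
    unfolding P_def[abs_def] by measurable
  note \<Psi> = indicator_test[of P n d, folded \<Psi>_def]
  show ?thesis
  proof (intro bexI worst_error_le)
    interpret P0: prob_space "sample_law n d (gauss_density d)"
      unfolding gauss_density_eq_mixture[of d "\<lambda>_. 0"] by (rule prob_space_sample_law) auto
    have "P0.prob {X \<in> space (sample_law n d (gauss_density d)). P X} \<le> Q\<^sup>2 * real d / t\<^sup>2"
      using split_statistic_Chebyshev[OF _ _ m d Q \<open>0 < t\<close>, of 0 0 "\<lambda>_. 0" 0]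
      by (simp add: P_def gauss_density_eq_mixture[of d "\<lambda>_. 0"])
    also have "\<dots> = \<alpha>"
      using \<open>0 < Q\<close> w \<open>0 < \<alpha>\<close> d by (simp add: t_def power_divide power_mult_distrib)
    finally show "\<Psi> \<in> level_tests n d \<alpha>"
      using \<Psi>(1) \<open>0 < \<alpha>\<close> by (simp add: level_tests_def \<Psi>(2)[simplified] P0.emeasure_eq_measure ennreal_leI)
  next
    fix \<epsilon> \<mu> assume *: "(\<epsilon>, \<mu>) \<in> separated_class norm2 d M (C * real d powr (1/4) / sqrt (real n))"
    note sep = separated_classD[OF *]
    have \<epsilon>: "0 \<le> \<epsilon>" "\<epsilon> \<le> 1" using sep by auto
    interpret P1: prob_space "sample_law n d (mixture_density d \<epsilon> \<mu>)"
      by (rule prob_space_sample_law) fact+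
    define R where "R = (\<Sum>j<d. (\<mu> j)\<^sup>2)"
    have "R \<le> M\<^sup>2"
      using sep(3) norm2_nonneg[of d \<mu>] unfolding R_def norm2_power2[symmetric] by (intro power_mono)
    have "(C * real d powr (1/4) / sqrt (real n))\<^sup>2 \<le> (\<epsilon> * norm2 d \<mu>)\<^sup>2"
      using sep C \<open>0 < M\<close> by (intro power_mono) auto
    also have "(C * real d powr (1/4) / sqrt (real n))\<^sup>2 = Q * w * (C\<^sup>2 / 3)"
    proof -
      have "(real d powr (1/4))\<^sup>2 = w"
        using d by (simp add: w_def powr_power powr_half_sqrt)
      then show ?thesis by (simp add: power_divide power_mult_distrib Q_def)
    qed
    also have "(\<epsilon> * norm2 d \<mu>)\<^sup>2 = \<epsilon>\<^sup>2 * R" by (simp add: power_mult_distrib R_def norm2_power2)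
    finally have s: "Q * w * (C\<^sup>2 / 3) \<le> \<epsilon>\<^sup>2 * R" .
    have "2 * t = Q * w * ((6 / sqrt \<alpha>) / 3)" by (simp add: t_def)
    also have "\<dots> \<le> Q * w * (C\<^sup>2 / 3)" using C(3) \<open>0 < Q\<close> w by (intro mult_left_mono divide_right_mono) auto
    finally have t: "2 * t \<le> \<epsilon>\<^sup>2 * R" using s by linarith
    let ?S = "space (sample_law n d (mixture_density d \<epsilon> \<mu>))"
    have "P1.prob {X \<in> ?S. \<not> P X}
      \<le> P1.prob {X \<in> ?S. \<epsilon>\<^sup>2 * R / 2 \<le> \<bar>split_statistic m n d X - \<epsilon>\<^sup>2 * R\<bar>}"
    proof (intro P1.finite_measure_mono)
      show "{X \<in> ?S. \<not> P X} \<subseteq> {X \<in> ?S. \<epsilon>\<^sup>2 * R / 2 \<le> \<bar>split_statistic m n d X - \<epsilon>\<^sup>2 * R\<bar>}"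
      proof safe
        fix X assume "\<not> P X"
        then have "split_statistic m n d X < t" by (simp add: P_def)
        then show "\<epsilon>\<^sup>2 * R / 2 \<le> \<bar>split_statistic m n d X - \<epsilon>\<^sup>2 * R\<bar>" using t by linarith
      qed
    qed simp
    also have "\<dots> \<le> (Q\<^sup>2 * real d * (1 + M\<^sup>2)\<^sup>2 + 2 * Q * (\<epsilon>\<^sup>2 * R) * (1 + M\<^sup>2)) / (\<epsilon>\<^sup>2 * R / 2)\<^sup>2"
      using t \<open>0 < t\<close>
      by (intro split_statistic_Chebyshev[OF \<epsilon> m d Q _ R_def \<open>R \<le> M\<^sup>2\<close>]) auto
    also have "\<dots> \<le> \<beta>"
      unfolding w(2)[symmetric] using assms \<open>0 < Q\<close> w s
      by (intro l2_error_arithmetic[where x="C\<^sup>2 / 3"]) auto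
    finally show "test_prob n d (mixture_density d \<epsilon> \<mu>) \<Psi> 0 \<le> ennreal \<beta>"
      by (simp add: \<Psi>(3) P1.emeasure_eq_measure ennreal_leI)
  qed
qed

section \<open>A test for the sup norm\<close>

lemma norm_sup_attained:
  assumes "1 \<le> d"
  obtains j where "j < d" "norm_sup d \<mu> = \<bar>\<mu> j\<bar>"
proof -
  have "norm_sup d \<mu> \<in> (\<lambda>j. \<bar>\<mu> j\<bar>) ` {..<d}"
    unfolding norm_sup_def using assms by (intro Max_in) (auto simp: lessThan_empty_iff)
  then show ?thesis using that by auto
qed

text \<open>
  The Chernoff bound: Markov's inequality for \<open>exp (n * \<tau> * \<sigma> * mean)\<close>, with the moment generating
  function of the standard normal law. The sign \<open>\<sigma>\<close> covers both tails.
\<close>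

lemma sample_mean_null_tail:
  assumes j: "j < d" and n: "1 \<le> n" and "0 < \<tau>" and \<sigma>: "\<sigma> = 1 \<or> \<sigma> = (-1::real)"
  shows "measure (sample_law n d (gauss_density d))
     {X \<in> space (sample_law n d (gauss_density d)). \<tau> \<le> \<sigma> * sample_mean {..<n} (\<lambda>x. x j) X}
     \<le> exp (- (real n * \<tau>\<^sup>2 / 2))"
proof -
  interpret product_prob_space "\<lambda>_. mixture_law d 0 (\<lambda>_. 0)" "{..<n}"
    by (rule product_prob_space_mixture) auto
  have law: "sample_law n d (gauss_density d) = PiM {..<n} (\<lambda>_. mixture_law d 0 (\<lambda>_. 0))"
    unfolding gauss_density_eq_mixture[of d "\<lambda>_. 0"] sample_law_eq ..
  have [measurable]: "sample_mean {..<n} (\<lambda>x. x j) \<in> borel_measurable (sample_law n d (gauss_density d))"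
    using measurable_sample_mean_coord[of "{..<n}" n j d] j
    by (simp cong: measurable_cong_sets)
  define lam where "lam = \<sigma> * \<tau>"
  have lam: "lam\<^sup>2 = \<tau>\<^sup>2" using \<sigma> by (auto simp: lam_def)
  have "has_bochner_integral (gauss_law d (\<lambda>_. 0)) (\<lambda>x. exp (lam * x j)) (exp (lam * 0 + lam\<^sup>2 / 2))"
    using has_bochner_integral_exp_normal_density[of 0 lam]
    by (intro has_bochner_integral_gauss_law_coord[OF j]) auto
  from has_bochner_integral_mixture_law[OF _ _ this this, of 0]
  have "has_bochner_integral (mixture_law d 0 (\<lambda>_. 0)) (\<lambda>x. exp (lam * x j)) (exp (\<tau>\<^sup>2 / 2))"
    by (simp add: lam)
  then have "has_bochner_integral (sample_law n d (gauss_density d))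
      (\<lambda>X. \<Prod>i<n. exp (lam * X i j)) (\<Prod>i<n. exp (\<tau>\<^sup>2 / 2))"
    unfolding law by (intro has_bochner_integral_PiM_prod) auto
  also have "(\<lambda>X. \<Prod>i<n. exp (lam * X i j)) = (\<lambda>X. exp (real n * \<tau> * (\<sigma> * sample_mean {..<n} (\<lambda>x. x j) X)))"
    using n by (simp add: exp_sum[symmetric] sample_mean_def sum_distrib_left[symmetric] lam_def mult_ac)
  also have "(\<Prod>i<n. exp (\<tau>\<^sup>2 / 2)) = exp (real n * \<tau>\<^sup>2 / 2)"
    by (simp add: exp_of_nat_mult[symmetric])
  finally have E: "has_bochner_integral (sample_law n d (gauss_density d))
     (\<lambda>X. exp (real n * \<tau> * (\<sigma> * sample_mean {..<n} (\<lambda>x. x j) X))) (exp (real n * \<tau>\<^sup>2 / 2))" .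
  have "measure (sample_law n d (gauss_density d))
     {X \<in> space (sample_law n d (gauss_density d)). \<tau> \<le> \<sigma> * sample_mean {..<n} (\<lambda>x. x j) X}
   = measure (sample_law n d (gauss_density d))
     {X \<in> space (sample_law n d (gauss_density d)).
        exp (real n * \<tau> * \<tau>) \<le> exp (real n * \<tau> * (\<sigma> * sample_mean {..<n} (\<lambda>x. x j) X))}"
    using n \<open>0 < \<tau>\<close> by simp
  also have "\<dots> \<le> exp (real n * \<tau>\<^sup>2 / 2) / exp (real n * \<tau> * \<tau>)"
    using E by (intro order_trans[OF integral_Markov_inequality_measure[where A="{}"]])
      (auto simp: has_bochner_integral_iff)
  also have "\<dots> = exp (- (real n * \<tau>\<^sup>2 / 2))"
    by (simp add: exp_diff[symmetric] power2_eq_square)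
  finally show ?thesis .
qed

text \<open>
  The threshold \<open>\<tau>\<close> makes the sum of the \<open>2 * d\<close> tail bounds equal to \<open>\<alpha>\<close>. Because \<open>2 \<le> d\<close>, it is at
  most half of the separation \<open>\<rho>\<close> when \<open>C\<close> is large, and so the mean of a coordinate that attains the
  sup norm has to deviate by at least \<open>\<rho> / 2\<close> for the test to miss the alternative.
\<close>

lemma sup_upper_bound:
  fixes M \<alpha> \<beta> C :: real and n d :: nat
  assumes "0 < M" "0 < \<alpha>" "\<alpha> < 1" "0 < \<beta>" and n: "1 \<le> n" and d: "2 \<le> d"
    and C: "0 < C" "4 * (1 + M\<^sup>2) / (\<beta> * ln 2) \<le> C\<^sup>2" "8 * (1 + ln (2 / \<alpha>) / ln 2) \<le> C\<^sup>2"
  shows "\<exists>\<Psi>\<in>level_tests n d \<alpha>.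
    worst_error n d (separated_class norm_sup d M (C * sqrt (ln (real d) / real n))) \<Psi> \<le> ennreal \<beta>"
proof -
  define \<tau> where "\<tau> = sqrt (2 * ln (2 * real d / \<alpha>) / real n)"
  have arg: "1 < 2 * real d / \<alpha>" using assms by (simp add: field_simps)
  have \<tau>: "0 < \<tau>" "\<tau>\<^sup>2 = 2 * ln (2 * real d / \<alpha>) / real n"
    using arg n by (auto simp: \<tau>_def)
  define mean where "mean j = sample_mean {..<n} (\<lambda>x::nat \<Rightarrow> real. x j)" for j
  define P where "P X \<longleftrightarrow> (\<exists>j\<in>{..<d}. \<tau> \<le> \<bar>mean j X\<bar>)" for X
  define \<Psi> where "\<Psi> = (\<lambda>X. if P X then 1 else (0::nat))"
  have meas[measurable]: "mean j \<in> borel_measurable (\<Pi>\<^sub>M i\<in>{..<n}. lebesgue_Rd d)" if "j < d" for j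
    unfolding mean_def using that by (intro measurable_sample_mean_coord) auto
  have [measurable]: "Measurable.pred (\<Pi>\<^sub>M i\<in>{..<n}. lebesgue_Rd d) P"
    unfolding P_def[abs_def] by (intro pred_intros_finite) auto
  note \<Psi> = indicator_test[of P n d, folded \<Psi>_def]
  show ?thesis
  proof (intro bexI worst_error_le)
    interpret P0: prob_space "sample_law n d (gauss_density d)"
      unfolding gauss_density_eq_mixture[of d "\<lambda>_. 0"] by (rule prob_space_sample_law) auto
    let ?S = "space (sample_law n d (gauss_density d))"
    define B where "B j \<sigma> = {X \<in> ?S. \<tau> \<le> \<sigma> * mean j X}" for j and \<sigma> :: real
    have B: "B j \<sigma> \<in> P0.events" if "j < d" for j \<sigma>
    proof -
      have "{X \<in> space (\<Pi>\<^sub>M i\<in>{..<n}. lebesgue_Rd d). \<tau> \<le> \<sigma> * mean j X}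
          \<in> sets (\<Pi>\<^sub>M i\<in>{..<n}. lebesgue_Rd d)"
        using that by measurable
      then show ?thesis by (simp add: B_def)
    qed
    have "{X \<in> ?S. P X} = (\<Union>j<d. B j 1 \<union> B j (-1))"
    proof (intro equalityI subsetI)
      fix X assume X: "X \<in> {X \<in> ?S. P X}"
      then obtain j where j: "j < d" "\<tau> \<le> \<bar>mean j X\<bar>" by (auto simp: P_def)
      then have "\<tau> \<le> 1 * mean j X \<or> \<tau> \<le> (-1) * mean j X" by linarith
      then show "X \<in> (\<Union>j<d. B j 1 \<union> B j (-1))" using X j(1) by (auto simp: B_def)
    next
      fix X assume "X \<in> (\<Union>j<d. B j 1 \<union> B j (-1))"
      then obtain j where j: "j < d" "X \<in> ?S" "\<tau> \<le> mean j X \<or> \<tau> \<le> - mean j X"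
        by (auto simp: B_def)
      then have "\<tau> \<le> \<bar>mean j X\<bar>" by linarith
      then show "X \<in> {X \<in> ?S. P X}" using j by (auto simp: P_def)
    qed
    then have "P0.prob {X \<in> ?S. P X} = P0.prob (\<Union>j<d. B j 1 \<union> B j (-1))"
      by simp
    also have "\<dots> \<le> (\<Sum>j<d. P0.prob (B j 1 \<union> B j (-1)))"
      by (intro P0.finite_measure_subadditive_finite) (auto intro!: sets.Un B simp del: sets_sample_law)
    also have "\<dots> \<le> (\<Sum>j<d. 2 * exp (- (real n * \<tau>\<^sup>2 / 2)))"
    proof (intro sum_mono)
      fix j assume "j \<in> {..<d}"
      then have "P0.prob (B j 1 \<union> B j (-1)) \<le> P0.prob (B j 1) + P0.prob (B j (-1))"
        by (intro measure_Un_le B) auto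
      also have "\<dots> \<le> exp (- (real n * \<tau>\<^sup>2 / 2)) + exp (- (real n * \<tau>\<^sup>2 / 2))"
        using \<open>j \<in> {..<d}\<close> \<tau>(1) n unfolding B_def mean_def
        by (intro add_mono sample_mean_null_tail) auto
      finally show "P0.prob (B j 1 \<union> B j (-1)) \<le> 2 * exp (- (real n * \<tau>\<^sup>2 / 2))" by simp
    qed
    also have "\<dots> = \<alpha>"
      using n d arg \<open>0 < \<alpha>\<close> unfolding \<tau>(2) by (simp add: exp_minus)
    finally show "\<Psi> \<in> level_tests n d \<alpha>"
      using \<Psi>(1) \<open>0 < \<alpha>\<close> by (simp add: level_tests_def \<Psi>(2)[simplified] P0.emeasure_eq_measure ennreal_leI)
  next
    define \<rho> where "\<rho> = C * sqrt (ln (real d) / real n)"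
    have ln2d: "ln 2 \<le> ln (real d)" "0 < ln (2::real)" using d by auto
    then have "0 < ln (real d)" by linarith
    then have \<rho>: "0 < \<rho>" "\<rho>\<^sup>2 = C\<^sup>2 * ln (real d) / real n"
      using n C(1) by (auto simp: \<rho>_def power_mult_distrib)
    have "8 * ln (2 * real d / \<alpha>) = 8 * (ln (real d) + ln (2 / \<alpha>))"
      using d \<open>0 < \<alpha>\<close> by (simp add: ln_mult ln_div)
    also have "\<dots> \<le> 8 * (ln (real d) + ln (2 / \<alpha>) * (ln (real d) / ln 2))"
      using assms ln2d by (intro mult_left_mono add_left_mono) (auto simp: mult_le_cancel_left1 field_simps)
    also have "\<dots> = 8 * (1 + ln (2 / \<alpha>) / ln 2) * ln (real d)"
      by (simp add: field_simps)
    also have "\<dots> \<le> C\<^sup>2 * ln (real d)"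
      using C(3) \<open>0 < ln (real d)\<close> by (intro mult_right_mono) auto
    finally have "4 * \<tau>\<^sup>2 \<le> \<rho>\<^sup>2" unfolding \<rho>(2) \<tau>(2) using n by (simp add: divide_right_mono)
    then have "(2 * \<tau>)\<^sup>2 \<le> \<rho>\<^sup>2" by (simp add: power_mult_distrib)
    then have \<tau>\<rho>: "2 * \<tau> \<le> \<rho>" using \<rho>(1) by (rule power2_le_imp_le[OF _ less_imp_le])
    fix \<epsilon> \<mu> assume *: "(\<epsilon>, \<mu>) \<in> separated_class norm_sup d M (C * sqrt (ln (real d) / real n))"
    note sep = separated_classD[OF *, folded \<rho>_def]
    have \<epsilon>: "0 \<le> \<epsilon>" "\<epsilon> \<le> 1" using sep by auto
    obtain j where j: "j < d" "norm_sup d \<mu> = \<bar>\<mu> j\<bar>" using norm_sup_attained[of d \<mu>] d by auto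
    interpret P1: prob_space "sample_law n d (mixture_density d \<epsilon> \<mu>)"
      by (rule prob_space_sample_law) fact+
    let ?S = "space (sample_law n d (mixture_density d \<epsilon> \<mu>))"
    have [measurable]: "mean j \<in> borel_measurable (sample_law n d (mixture_density d \<epsilon> \<mu>))"
      using meas[OF j(1)] by (simp cong: measurable_cong_sets)
    have \<mu>: "(\<mu> j)\<^sup>2 \<le> M\<^sup>2" using sep(3) j(2) \<open>0 < M\<close> by (simp add: abs_le_square_iff[symmetric])
    have "P1.prob {X \<in> ?S. \<not> P X} \<le> P1.prob {X \<in> ?S. \<rho> / 2 \<le> \<bar>mean j X - \<epsilon> * \<mu> j\<bar>}"
    proof (intro P1.finite_measure_mono)
      show "{X \<in> ?S. \<not> P X} \<subseteq> {X \<in> ?S. \<rho> / 2 \<le> \<bar>mean j X - \<epsilon> * \<mu> j\<bar>}"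
      proof safe
        fix X assume "\<not> P X"
        then have "\<not> \<tau> \<le> \<bar>mean j X\<bar>" using j(1) unfolding P_def by blast
        moreover have "\<rho> < \<bar>\<epsilon> * \<mu> j\<bar>" using sep(4) j \<epsilon> by (simp add: abs_mult)
        ultimately show "\<rho> / 2 \<le> \<bar>mean j X - \<epsilon> * \<mu> j\<bar>" using \<tau>\<rho> by linarith
      qed
    qed measurable
    also have "\<dots> \<le> ((\<epsilon>\<^sup>2 + \<epsilon> * (1 - \<epsilon>) / card {..<n}) * (\<mu> j * \<mu> j) + (if j = j then 1 / card {..<n} else 0)
         - (\<epsilon> * \<mu> j)\<^sup>2) / (\<rho> / 2)\<^sup>2"
      unfolding sample_law_eq mean_def using \<rho> n j(1) \<epsilon>
      by (intro prob_space.has_bochner_integral_Chebyshev has_bochner_integral_mixture_mean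
          has_bochner_integral_mixture_mean_mult prob_space_PiM prob_space_mixture_law)
         (auto simp: lessThan_empty_iff)
    also have "\<dots> = 4 * (1 + \<epsilon> * (1 - \<epsilon>) * (\<mu> j)\<^sup>2) / (real n * \<rho>\<^sup>2)"
      using n \<rho>(1) by (simp add: field_simps power2_eq_square)
    also have "\<dots> \<le> 4 * (1 + 1 * M\<^sup>2) / (real n * \<rho>\<^sup>2)"
      using \<epsilon> \<mu> by (intro divide_right_mono mult_left_mono add_left_mono mult_mono mult_le_one) auto
    also have "\<dots> = 4 * (1 + M\<^sup>2) / (C\<^sup>2 * ln (real d))"
      using n by (simp add: \<rho>(2))
    also have "\<dots> \<le> 4 * (1 + M\<^sup>2) / (C\<^sup>2 * ln 2)"
      using ln2d \<open>0 < ln (real d)\<close> C(1)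
      by (intro divide_left_mono mult_left_mono mult_pos_pos) (auto simp: add_nonneg_nonneg)
    also have "\<dots> \<le> \<beta>"
      using C(1,2) ln2d \<open>0 < \<beta>\<close> by (simp add: field_simps)
    finally show "test_prob n d (mixture_density d \<epsilon> \<mu>) \<Psi> 0 \<le> ennreal \<beta>"
      by (simp add: \<Psi>(3) P1.emeasure_eq_measure ennreal_leI)
  qed
qed

section \<open>Lower bounds from the second moment of the mixed likelihood ratio\<close>

text \<open>
  Let \<open>Lbar\<close> be the average of the likelihood ratios \<open>L \<theta>\<close>. Its second moment is at most \<open>1 + \<eta>\<^sup>2\<close>, so the
  second moment of \<open>Lbar - 1\<close> is at most \<open>\<eta>\<^sup>2\<close>, and the average over \<open>\<theta>\<close> of the probabilities of \<open>A\<close> under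
  the laws with densities \<open>L \<theta>\<close> differs from \<open>prob A\<close> by at most \<open>\<eta>\<close>. Some \<open>\<theta>\<close> does at least as well as
  the average.
\<close>

lemma (in prob_space) chi_square_lower_bound:
  fixes L :: "'b \<Rightarrow> 'a \<Rightarrow> real"
  assumes \<Theta>: "finite \<Theta>" "\<Theta> \<noteq> {}" and nn: "\<And>\<theta> x. \<theta> \<in> \<Theta> \<Longrightarrow> 0 \<le> L \<theta> x"
    and L: "\<And>\<theta>. \<theta> \<in> \<Theta> \<Longrightarrow> has_bochner_integral M (L \<theta>) 1"
    and LL: "\<And>\<theta> \<theta>'. \<theta> \<in> \<Theta> \<Longrightarrow> \<theta>' \<in> \<Theta> \<Longrightarrow> has_bochner_integral M (\<lambda>x. L \<theta> x * L \<theta>' x) (K \<theta> \<theta>')"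
    and K: "(\<Sum>\<theta>\<in>\<Theta>. \<Sum>\<theta>'\<in>\<Theta>. K \<theta> \<theta>') \<le> (real (card \<Theta>))\<^sup>2 * (1 + \<eta>\<^sup>2)"
    and "0 < \<eta>" and A: "A \<in> events"
  shows "\<exists>\<theta>\<in>\<Theta>. ennreal (prob A - \<eta>) \<le> emeasure (density M (L \<theta>)) A"
proof -
  define N where "N = real (card \<Theta>)"
  have N: "0 < N" using \<Theta> by (simp add: N_def card_gt_0_iff)
  define Lbar where "Lbar x = (\<Sum>\<theta>\<in>\<Theta>. L \<theta> x) / N" for x
  define S where "S = (\<Sum>\<theta>\<in>\<Theta>. \<Sum>\<theta>'\<in>\<Theta>. K \<theta> \<theta>') / N\<^sup>2"
  have S: "S \<le> 1 + \<eta>\<^sup>2" using K N by (simp add: S_def N_def[symmetric] divide_le_eq mult.commute)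
  have Lbar: "has_bochner_integral M Lbar 1"
  proof -
    have "has_bochner_integral M (\<lambda>x. (\<Sum>\<theta>\<in>\<Theta>. L \<theta> x) / N) ((\<Sum>\<theta>\<in>\<Theta>. 1) / N)"
      by (intro has_bochner_integral_divide has_bochner_integral_sum L)
    then show ?thesis using N by (simp add: Lbar_def[abs_def] N_def)
  qed
  have Lbar2: "has_bochner_integral M (\<lambda>x. (Lbar x)\<^sup>2) S"
  proof -
    have "has_bochner_integral M (\<lambda>x. (\<Sum>\<theta>\<in>\<Theta>. \<Sum>\<theta>'\<in>\<Theta>. L \<theta> x * L \<theta>' x) / N\<^sup>2) S"
      unfolding S_def by (intro has_bochner_integral_divide has_bochner_integral_sum LL)
    then show ?thesis by (simp add: Lbar_def power_divide power2_eq_square[of "sum _ _"] sum_product)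
  qed
  have [measurable]: "A \<in> sets M" by fact
  have LA: "integrable M (\<lambda>x. L \<theta> x * indicator A x)" if "\<theta> \<in> \<Theta>" for \<theta>
    using L[OF that] by (intro integrable_real_mult_indicator) (auto simp: has_bochner_integral_iff)
  have const: "has_bochner_integral M (\<lambda>_. c) c" for c :: real
    by (simp add: has_bochner_integral_iff prob_space)
  \<comment> \<open>The inequality between arithmetic and geometric means, \<open>2 * \<bar>x\<bar> \<le> \<eta> + x\<^sup>2 / \<eta>\<close> for \<open>x = Lbar - 1\<close>,
    serves as the Cauchy-Schwarz inequality.\<close>
  let ?lower = "\<lambda>x. indicator A x - (\<eta> + ((Lbar x)\<^sup>2 - 2 * Lbar x + 1) / \<eta>) / 2"
  have lower: "has_bochner_integral M ?lower (prob A - (\<eta> + (S - 2 * 1 + 1) / \<eta>) / 2)"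
    by (intro has_bochner_integral_diff has_bochner_integral_add has_bochner_integral_divide
        has_bochner_integral_mult_right Lbar Lbar2 const)
       (auto simp: has_bochner_integral_iff emeasure_eq_measure)
  have "prob A - \<eta> \<le> prob A - (\<eta> + (S - 1) / \<eta>) / 2"
    using S \<open>0 < \<eta>\<close> by (simp add: field_simps power2_eq_square)
  also have "\<dots> = integral\<^sup>L M ?lower"
    using has_bochner_integral_integral_eq[OF lower] by simp
  also have "\<dots> \<le> (\<integral>x. Lbar x * indicator A x \<partial>M)"
  proof (rule integral_mono)
    show "integrable M ?lower"
      using lower by (simp add: has_bochner_integral_iff)
    show "integrable M (\<lambda>x. Lbar x * indicator A x)"
      using Lbar by (intro integrable_real_mult_indicator) (auto simp: has_bochner_integral_iff)
    fix x
    have "0 \<le> (\<eta> - (Lbar x - 1))\<^sup>2 / \<eta>" "0 \<le> (\<eta> + (Lbar x - 1))\<^sup>2 / \<eta>" using \<open>0 < \<eta>\<close> by auto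
    then have abs_le: "\<bar>Lbar x - 1\<bar> \<le> (\<eta> + ((Lbar x)\<^sup>2 - 2 * Lbar x + 1) / \<eta>) / 2"
      using \<open>0 < \<eta>\<close> by (auto simp: field_simps power2_eq_square abs_if)
    show "?lower x \<le> Lbar x * indicator A x"
    proof (cases "x \<in> A")
      case True
      then have "indicator A x = (1::real)" "Lbar x * indicator A x = Lbar x" by auto
      then show ?thesis using abs_le by linarith
    next
      case False
      then have "indicator A x = (0::real)" "Lbar x * indicator A x = 0" by auto
      then show ?thesis using abs_le by linarith
    qed
  qed
  also have "\<dots> = (\<Sum>\<theta>\<in>\<Theta>. \<integral>x. L \<theta> x * indicator A x \<partial>M) / N"
    using LA by (simp add: Lbar_def sum_distrib_right)
  finally have avg: "(\<Sum>\<theta>\<in>\<Theta>. prob A - \<eta>) \<le> (\<Sum>\<theta>\<in>\<Theta>. \<integral>x. L \<theta> x * indicator A x \<partial>M)"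
    using N by (simp add: N_def field_simps)
  have "\<exists>\<theta>\<in>\<Theta>. prob A - \<eta> \<le> (\<integral>x. L \<theta> x * indicator A x \<partial>M)"
  proof (rule ccontr)
    assume "\<not> ?thesis"
    then have "(\<Sum>\<theta>\<in>\<Theta>. \<integral>x. L \<theta> x * indicator A x \<partial>M) < (\<Sum>\<theta>\<in>\<Theta>. prob A - \<eta>)"
      using \<Theta> by (intro sum_strict_mono) auto
    with avg show False by simp
  qed
  then obtain \<theta> where \<theta>: "\<theta> \<in> \<Theta>" "prob A - \<eta> \<le> (\<integral>x. L \<theta> x * indicator A x \<partial>M)" by blast
  have [measurable]: "L \<theta> \<in> borel_measurable M"
    using L[OF \<theta>(1)] by (auto simp: has_bochner_integral_iff)
  have "emeasure (density M (L \<theta>)) A = (\<integral>\<^sup>+x. ennreal (L \<theta> x * indicator A x) \<partial>M)"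
    by (subst emeasure_density) (auto intro!: nn_integral_cong split: split_indicator)
  also have "\<dots> = ennreal (\<integral>x. L \<theta> x * indicator A x \<partial>M)"
    using LA[OF \<theta>(1)] nn[OF \<theta>(1)] by (intro nn_integral_eq_integral) auto
  finally show ?thesis using \<theta> by (auto intro!: bexI[of _ \<theta>] ennreal_leI)
qed

text \<open>
  The likelihood ratio of one observation against the standard normal law.
\<close>

definition lratio :: "nat \<Rightarrow> real \<Rightarrow> (nat \<Rightarrow> real) \<Rightarrow> (nat \<Rightarrow> real) \<Rightarrow> real" where
  "lratio d \<epsilon> \<mu> x = (1 - \<epsilon>) + \<epsilon> * exp (\<Sum>j<d. \<mu> j * x j - (\<mu> j)\<^sup>2 / 2)"

lemma measurable_lratio [measurable]: "lratio d \<epsilon> \<mu> \<in> borel_measurable (lebesgue_Rd d)"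
  unfolding lratio_def[abs_def] by measurable

lemma lratio_nonneg: "0 \<le> \<epsilon> \<Longrightarrow> \<epsilon> \<le> 1 \<Longrightarrow> 0 \<le> lratio d \<epsilon> \<mu> x"
  by (simp add: lratio_def)

lemma mixture_density_eq_lratio: "mixture_density d \<epsilon> \<mu> x = gauss_density d x * lratio d \<epsilon> \<mu> x"
proof -
  have "std_normal_density (a - b) = std_normal_density a * exp (b * a - b\<^sup>2 / 2)" for a b :: real
  proof -
    have "- (a - b)\<^sup>2 / 2 = - a\<^sup>2 / 2 + (b * a - b\<^sup>2 / 2)" by (simp add: power2_eq_square field_simps)
    then show ?thesis by (simp add: std_normal_density_def exp_add[symmetric])
  qed
  then have "gauss_density d (\<lambda>j. x j - \<mu> j) = gauss_density d x * exp (\<Sum>j<d. \<mu> j * x j - (\<mu> j)\<^sup>2 / 2)"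
    by (simp add: gauss_density_def prod.distrib exp_sum)
  then show ?thesis by (simp add: mixture_density_def lratio_def algebra_simps)
qed

lemma gauss_law_null: "gauss_law d (\<lambda>_. 0) = density (lebesgue_Rd d) (gauss_density d)"
  by (simp add: gauss_law_density)

lemma sample_law_gauss: "sample_law n d (gauss_density d) = PiM {..<n} (\<lambda>_. gauss_law d (\<lambda>_. 0))"
  by (simp add: sample_law_def gauss_law_null)

lemma product_prob_space_gauss_law: "product_prob_space (\<lambda>_. gauss_law d \<mu>)"
  by (intro product_prob_spaceI prob_space_gauss_law)

lemma sample_law_mixture_density:
  assumes "0 \<le> \<epsilon>" "\<epsilon> \<le> 1"
  shows "sample_law n d (mixture_density d \<epsilon> \<mu>)
    = density (sample_law n d (gauss_density d)) (\<lambda>X. \<Prod>i<n. lratio d \<epsilon> \<mu> (X i))"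
proof -
  interpret product_prob_space "\<lambda>_::nat. gauss_law d (\<lambda>_. 0)" by (rule product_prob_space_gauss_law)
  have eq: "mixture_law d \<epsilon> \<mu> = density (gauss_law d (\<lambda>_. 0)) (lratio d \<epsilon> \<mu>)"
    unfolding gauss_law_null mixture_law_def
    by (subst density_density_eq)
       (auto simp: mixture_density_eq_lratio ennreal_mult lratio_nonneg assms gauss_density_nonneg)
  show ?thesis
    unfolding sample_law_eq eq sample_law_gauss
    using assms prob_space_mixture_law[OF assms, of d \<mu>]
    by (intro PiM_density product_sigma_finite_axioms)
       (auto simp: eq lratio_nonneg cong: measurable_cong_sets)
qed

lemma has_bochner_integral_gauss_law_tilt:
  "has_bochner_integral (gauss_law d (\<lambda>_. 0)) (\<lambda>x. exp (\<Sum>j<d. \<mu> j * x j - (\<mu> j)\<^sup>2 / 2)) 1"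
proof -
  have "has_bochner_integral (gauss_law d (\<lambda>_. 0))
     (\<lambda>x. exp (- (\<Sum>j<d. (\<mu> j)\<^sup>2 / 2)) * exp (\<Sum>j<d. \<mu> j * x j))
     (exp (- (\<Sum>j<d. (\<mu> j)\<^sup>2 / 2)) * exp (\<Sum>j<d. (\<mu> j)\<^sup>2 / 2))"
    by (intro has_bochner_integral_mult_right has_bochner_integral_gauss_law_exp)
  then show ?thesis by (simp add: exp_add[symmetric] sum_subtractf)
qed

text \<open>
  With \<open>e \<mu> x = exp (\<langle>\<mu>, x\<rangle> - \<parallel>\<mu>\<parallel>\<^sup>2 / 2)\<close> one has \<open>e \<mu> * e \<nu> = exp \<langle>\<mu>, \<nu>\<rangle> * e (\<mu> + \<nu>)\<close>, and every \<open>e \<mu>\<close>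
  integrates to \<open>1\<close>.
\<close>

lemma has_bochner_integral_lratio_mult:
  "has_bochner_integral (gauss_law d (\<lambda>_. 0)) (\<lambda>x. lratio d \<epsilon> \<mu> x * lratio d \<epsilon> \<nu> x)
     (1 + \<epsilon>\<^sup>2 * (exp (\<Sum>j<d. \<mu> j * \<nu> j) - 1))"
proof -
  interpret prob_space "gauss_law d (\<lambda>_. 0)" by (rule prob_space_gauss_law)
  let ?e = "\<lambda>\<mu> x. exp (\<Sum>j<d. \<mu> j * x j - (\<mu> j)\<^sup>2 / 2)"
  let ?c = "exp (\<Sum>j<d. \<mu> j * \<nu> j)"
  have "?c * ?e (\<lambda>j. \<mu> j + \<nu> j) x = ?e \<mu> x * ?e \<nu> x" for x :: "nat \<Rightarrow> real"
    unfolding exp_add[symmetric] sum.distrib[symmetric]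
    by (intro arg_cong[where f=exp] sum.cong) (auto simp: power2_eq_square field_simps)
  then have ee: "has_bochner_integral (gauss_law d (\<lambda>_. 0)) (\<lambda>x. ?e \<mu> x * ?e \<nu> x) (?c * 1)"
    using has_bochner_integral_mult_right[OF has_bochner_integral_gauss_law_tilt, where c="?c", of d "\<lambda>j. \<mu> j + \<nu> j"]
    by simp
  have "has_bochner_integral (gauss_law d (\<lambda>_. 0))
     (\<lambda>x. (1 - \<epsilon>)\<^sup>2 * 1 + (1 - \<epsilon>) * \<epsilon> * ?e \<mu> x + (1 - \<epsilon>) * \<epsilon> * ?e \<nu> x + \<epsilon>\<^sup>2 * (?e \<mu> x * ?e \<nu> x))
     ((1 - \<epsilon>)\<^sup>2 * 1 + (1 - \<epsilon>) * \<epsilon> * 1 + (1 - \<epsilon>) * \<epsilon> * 1 + \<epsilon>\<^sup>2 * (?c * 1))"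
    by (intro has_bochner_integral_add has_bochner_integral_mult_right has_bochner_integral_gauss_law_tilt ee)
       (simp add: has_bochner_integral_iff prob_space)
  also have "(\<lambda>x. (1 - \<epsilon>)\<^sup>2 * 1 + (1 - \<epsilon>) * \<epsilon> * ?e \<mu> x + (1 - \<epsilon>) * \<epsilon> * ?e \<nu> x + \<epsilon>\<^sup>2 * (?e \<mu> x * ?e \<nu> x))
      = (\<lambda>x. lratio d \<epsilon> \<mu> x * lratio d \<epsilon> \<nu> x)"
    unfolding lratio_def by (intro ext) algebra
  also have "(1 - \<epsilon>)\<^sup>2 * 1 + (1 - \<epsilon>) * \<epsilon> * 1 + (1 - \<epsilon>) * \<epsilon> * 1 + \<epsilon>\<^sup>2 * (?c * 1) = 1 + \<epsilon>\<^sup>2 * (?c - 1)"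
    by algebra
  finally show ?thesis .
qed

lemma has_bochner_integral_lratio: "has_bochner_integral (gauss_law d (\<lambda>_. 0)) (lratio d \<epsilon> \<mu>) 1"
proof -
  interpret prob_space "gauss_law d (\<lambda>_. 0)" by (rule prob_space_gauss_law)
  have "has_bochner_integral (gauss_law d (\<lambda>_. 0))
     (\<lambda>x. (1 - \<epsilon>) + \<epsilon> * exp (\<Sum>j<d. \<mu> j * x j - (\<mu> j)\<^sup>2 / 2)) ((1 - \<epsilon>) + \<epsilon> * 1)"
    by (intro has_bochner_integral_add has_bochner_integral_mult_right has_bochner_integral_gauss_law_tilt)
       (simp add: has_bochner_integral_iff prob_space)
  then show ?thesis by (simp add: lratio_def[abs_def])
qed

text \<open>
  The event \<open>\<Psi> = 0\<close> has null probability at least \<open>1 - \<alpha>\<close>, and by independence the second moment of the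
  likelihood ratio of the sample is the \<open>n\<close>-th power of the one of a single observation.
\<close>

lemma worst_error_lower_bound:
  fixes \<mu> :: "'b \<Rightarrow> nat \<Rightarrow> real"
  assumes \<epsilon>: "0 \<le> \<epsilon>" "\<epsilon> \<le> 1" and \<Theta>: "finite \<Theta>" "\<Theta> \<noteq> {}" and A: "\<And>\<theta>. \<theta> \<in> \<Theta> \<Longrightarrow> (\<epsilon>, \<mu> \<theta>) \<in> A"
    and K: "(\<Sum>\<theta>\<in>\<Theta>. \<Sum>\<theta>'\<in>\<Theta>. (1 + \<epsilon>\<^sup>2 * (exp (\<Sum>j<d. \<mu> \<theta> j * \<mu> \<theta>' j) - 1)) ^ n)
        \<le> (real (card \<Theta>))\<^sup>2 * (1 + \<eta>\<^sup>2)"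
    and "0 < \<eta>" and \<Psi>: "\<Psi> \<in> level_tests n d \<alpha>" and "0 \<le> \<alpha>"
  shows "ennreal (1 - \<alpha> - \<eta>) \<le> worst_error n d A \<Psi>"
proof -
  let ?P = "sample_law n d (gauss_density d)"
  let ?S = "space (\<Pi>\<^sub>M i\<in>{..<n}. lebesgue_Rd d)"
  let ?L = "\<lambda>\<theta> X. \<Prod>i<n. lratio d \<epsilon> (\<mu> \<theta>) (X i)"
  interpret prob_space ?P
    unfolding gauss_density_eq_mixture[of d "\<lambda>_. 0"] by (rule prob_space_sample_law) auto
  interpret G: product_prob_space "\<lambda>_::nat. gauss_law d (\<lambda>_. 0)" by (rule product_prob_space_gauss_law)
  have \<Psi>_meas: "\<Psi> \<in> (\<Pi>\<^sub>M i\<in>{..<n}. lebesgue_Rd d) \<rightarrow>\<^sub>M count_space {0, 1}"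
    using \<Psi> by (simp add: level_tests_def tests_def)
  define Z where "Z k = {X \<in> ?S. \<Psi> X = k}" for k
  have Z: "Z k \<in> events" for k
  proof -
    have "\<Psi> -` ({k} \<inter> {0,1}) \<inter> ?S \<in> sets (\<Pi>\<^sub>M i\<in>{..<n}. lebesgue_Rd d)"
      by (rule measurable_sets[OF \<Psi>_meas]) auto
    moreover have "\<Psi> -` ({k} \<inter> {0,1}) \<inter> ?S = Z k"
      using measurable_space[OF \<Psi>_meas] by (auto simp: Z_def)
    ultimately show ?thesis by simp
  qed
  have "ennreal (prob (Z 1)) \<le> ennreal \<alpha>"
    using \<Psi> by (simp add: level_tests_def test_prob_def Z_def emeasure_eq_measure)
  then have "prob (Z 1) \<le> \<alpha>" using \<open>0 \<le> \<alpha>\<close> by simp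
  moreover have "Z 0 = space ?P - Z 1"
    using measurable_space[OF \<Psi>_meas] by (auto simp: Z_def)
  ultimately have Z0: "1 - \<alpha> \<le> prob (Z 0)" using prob_compl[OF Z, of 1] by simp
  have 1: "has_bochner_integral ?P (?L \<theta>) 1" for \<theta>
  proof -
    have "has_bochner_integral ?P (?L \<theta>) (\<Prod>i<n. 1)"
      unfolding sample_law_gauss
      by (intro G.has_bochner_integral_PiM_prod has_bochner_integral_lratio finite_lessThan)
    then show ?thesis by simp
  qed
  have 2: "has_bochner_integral ?P (\<lambda>X. ?L \<theta> X * ?L \<theta>' X)
      ((1 + \<epsilon>\<^sup>2 * (exp (\<Sum>j<d. \<mu> \<theta> j * \<mu> \<theta>' j) - 1)) ^ n)" for \<theta> \<theta>'
  proof -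
    have "has_bochner_integral ?P (\<lambda>X. \<Prod>i<n. lratio d \<epsilon> (\<mu> \<theta>) (X i) * lratio d \<epsilon> (\<mu> \<theta>') (X i))
      (\<Prod>i<n. 1 + \<epsilon>\<^sup>2 * (exp (\<Sum>j<d. \<mu> \<theta> j * \<mu> \<theta>' j) - 1))"
      unfolding sample_law_gauss
      by (intro G.has_bochner_integral_PiM_prod[where f="\<lambda>_ x. lratio d \<epsilon> (\<mu> \<theta>) x * lratio d \<epsilon> (\<mu> \<theta>') x"]
          has_bochner_integral_lratio_mult finite_lessThan)
    then show ?thesis by (simp add: prod.distrib)
  qed
  from chi_square_lower_bound[OF \<Theta> _ 1 2 K \<open>0 < \<eta>\<close> Z, of 0]
  obtain \<theta> where \<theta>: "\<theta> \<in> \<Theta>" "ennreal (prob (Z 0) - \<eta>) \<le> emeasure (density ?P (?L \<theta>)) (Z 0)"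
    using \<epsilon> by (auto simp: prod_nonneg lratio_nonneg)
  have "ennreal (1 - \<alpha> - \<eta>) \<le> ennreal (prob (Z 0) - \<eta>)" using Z0 by (intro ennreal_leI) simp
  also have "\<dots> \<le> test_prob n d (mixture_density d \<epsilon> (\<mu> \<theta>)) \<Psi> 0"
    using \<theta>(2) unfolding test_prob_def sample_law_mixture_density[OF \<epsilon>, symmetric]
    by (simp add: Z_def)
  also have "\<dots> \<le> worst_error n d A \<Psi>"
    unfolding worst_error_def using A[OF \<theta>(1)] by (intro SUP_upper2[of "(\<epsilon>, \<mu> \<theta>)"]) auto
  finally show ?thesis .
qed

section \<open>Exponential moments of sums of random signs\<close>

lemma cosh_le_exp_half_square: "cosh x \<le> exp (x\<^sup>2 / 2)" for x :: real
proof -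
  have tanh_le: "tanh y \<le> y" if "0 \<le> y" for y :: real
  proof -
    have "(\<lambda>y. y - tanh y) 0 \<le> (\<lambda>y. y - tanh y) y"
      by (rule DERIV_nonneg_imp_nondecreasing[OF that])
         (auto intro!: exI derivative_eq_intros)
    then show ?thesis by simp
  qed
  have "cosh y \<le> exp (y\<^sup>2 / 2)" if "0 \<le> y" for y :: real
  proof -
    have "(\<lambda>y. y\<^sup>2 / 2 - ln (cosh y)) 0 \<le> (\<lambda>y. y\<^sup>2 / 2 - ln (cosh y)) y"
    proof (rule DERIV_nonneg_imp_nondecreasing[OF that])
      fix z :: real assume "0 \<le> z"
      have "((\<lambda>y. y\<^sup>2 / 2 - ln (cosh y)) has_real_derivative z - tanh z) (at z)"
        by (auto intro!: derivative_eq_intros simp: tanh_def cosh_real_pos)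
      then show "\<exists>D. ((\<lambda>y. y\<^sup>2 / 2 - ln (cosh y)) has_real_derivative D) (at z) \<and> 0 \<le> D"
        using tanh_le[OF \<open>0 \<le> z\<close>] by auto
    qed
    then have "ln (cosh y) \<le> y\<^sup>2 / 2" by simp
    then show ?thesis using cosh_real_pos[of y] by (metis exp_le_cancel_iff exp_ln)
  qed
  from this[of "\<bar>x\<bar>"] show ?thesis by (cases "0 \<le> x") auto
qed

text \<open>
  Multiplication by a fixed sign vector permutes the sign vectors, so the value does not depend on
  \<open>s\<close>; the sum factorises over the coordinates.
\<close>

lemma sum_sign_vectors_exp:
  fixes s :: "nat \<Rightarrow> real"
  assumes "s \<in> {..<d} \<rightarrow>\<^sub>E {-1, 1}"
  shows "(\<Sum>\<sigma>\<in>{..<d} \<rightarrow>\<^sub>E {-1, 1}. exp (w * (\<Sum>j<d. \<sigma> j * s j))) = (2 * cosh w) ^ d"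
proof -
  have "(\<Sum>\<sigma>\<in>{..<d} \<rightarrow>\<^sub>E {-1, 1}. exp (w * (\<Sum>j<d. \<sigma> j * s j)))
     = (\<Sum>\<sigma>\<in>{..<d} \<rightarrow>\<^sub>E {-1, 1}. \<Prod>j<d. exp (w * (\<sigma> j * s j)))"
    by (simp add: exp_sum sum_distrib_left)
  also have "\<dots> = (\<Prod>j<d. \<Sum>b\<in>{-1, 1}. exp (w * (b * s j)))"
    by (rule prod_sum_PiE[symmetric]) auto
  also have "\<dots> = (\<Prod>j<d. 2 * cosh w)"
  proof (intro prod.cong refl)
    fix j assume "j \<in> {..<d}"
    then have "s j = -1 \<or> s j = 1" using assms by (auto simp: PiE_iff)
    then show "(\<Sum>b\<in>{-1, 1}. exp (w * (b * s j))) = 2 * cosh w"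
      by (auto simp: cosh_def)
  qed
  finally show ?thesis by simp
qed

lemma has_bochner_integral_normal_exp_square:
  fixes k :: real
  assumes "k < 1 / 2"
  shows "has_bochner_integral lborel (\<lambda>g. std_normal_density g * exp (k * g\<^sup>2)) (1 / sqrt (1 - 2 * k))"
proof -
  define r where "r = sqrt (1 - 2 * k)"
  have r: "0 < r" "r\<^sup>2 = 1 - 2 * k" using assms by (auto simp: r_def)
  have "std_normal_density g * exp (k * g\<^sup>2) = 1 / r * normal_density 0 (1 / r) g" for g
  proof -
    have "- g\<^sup>2 / 2 + k * g\<^sup>2 = - (g\<^sup>2 * r\<^sup>2) / 2" unfolding r(2) by (simp add: field_simps)
    then show ?thesis
      using r(1) by (simp add: normal_density_def exp_add[symmetric] power_divide real_sqrt_divide)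
  qed
  moreover have "has_bochner_integral lborel (\<lambda>g. 1 / r * normal_density 0 (1 / r) g) (1 / r * 1)"
    using r(1) by (intro has_bochner_integral_mult_right) (simp add: has_bochner_integral_iff)
  ultimately show ?thesis by (simp add: r_def)
qed

text \<open>
  The square in the exponent is linearised by a Gaussian integral: \<open>exp (v * S\<^sup>2)\<close> is the expectation of
  \<open>exp (c * g * S)\<close> for a standard normal \<open>g\<close> and \<open>c = sqrt (2 * v)\<close>. The sum over the signs then factorises
  for each \<open>g\<close>, and \<open>cosh x \<le> exp (x\<^sup>2 / 2)\<close> leaves a Gaussian integral of an exponential of \<open>g\<^sup>2\<close>, which
  is finite because \<open>4 * d * v < 1\<close>.
\<close>

lemma sum_sign_vectors_exp_quadratic:
  fixes s :: "nat \<Rightarrow> real"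
  assumes s: "s \<in> {..<d} \<rightarrow>\<^sub>E {-1, 1}" and "0 \<le> v" "4 * real d * v < 1"
  shows "(\<Sum>\<sigma>\<in>{..<d} \<rightarrow>\<^sub>E {-1, 1}. exp (u * (\<Sum>j<d. \<sigma> j * s j) + v * (\<Sum>j<d. \<sigma> j * s j)\<^sup>2))
    \<le> 2 ^ d * (exp (real d * u\<^sup>2) / sqrt (1 - 4 * real d * v))"
proof -
  let ?\<Sigma> = "{..<d} \<rightarrow>\<^sub>E {-1, 1::real}"
  define S where "S \<sigma> = (\<Sum>j<d. \<sigma> j * s j)" for \<sigma>
  define c where "c = sqrt (2 * v)"
  have c: "c\<^sup>2 = 2 * v" using \<open>0 \<le> v\<close> by (simp add: c_def)
  have lin: "has_bochner_integral lborel (\<lambda>g. std_normal_density g * exp ((u + c * g) * S \<sigma>))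
     (exp (u * S \<sigma> + v * (S \<sigma>)\<^sup>2))" for \<sigma>
  proof -
    have "has_bochner_integral lborel (\<lambda>g. exp (u * S \<sigma>) * (std_normal_density g * exp (c * S \<sigma> * g)))
      (exp (u * S \<sigma>) * exp (c * S \<sigma> * 0 + (c * S \<sigma>)\<^sup>2 / 2))"
      by (intro has_bochner_integral_mult_right has_bochner_integral_exp_normal_density)
    moreover have "exp (u * S \<sigma>) * exp (c * S \<sigma> * 0 + (c * S \<sigma>)\<^sup>2 / 2) = exp (u * S \<sigma> + v * (S \<sigma>)\<^sup>2)"
      by (simp add: power_mult_distrib c exp_add)
    moreover have "(\<lambda>g. exp (u * S \<sigma>) * (std_normal_density g * exp (c * S \<sigma> * g)))
        = (\<lambda>g. std_normal_density g * exp ((u + c * g) * S \<sigma>))"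
      by (simp add: ring_distribs exp_add mult_ac)
    ultimately show ?thesis by (simp only:)
  qed
  have sum: "has_bochner_integral lborel (\<lambda>g. \<Sum>\<sigma>\<in>?\<Sigma>. std_normal_density g * exp ((u + c * g) * S \<sigma>))
     (\<Sum>\<sigma>\<in>?\<Sigma>. exp (u * S \<sigma> + v * (S \<sigma>)\<^sup>2))"
    by (intro has_bochner_integral_sum lin)
  have bound: "has_bochner_integral lborel
     (\<lambda>g. (2 ^ d * exp (real d * u\<^sup>2)) * (std_normal_density g * exp (2 * real d * v * g\<^sup>2)))
     ((2 ^ d * exp (real d * u\<^sup>2)) * (1 / sqrt (1 - 2 * (2 * real d * v))))"
    using assms(3) by (intro has_bochner_integral_mult_right has_bochner_integral_normal_exp_square) simp
  have "(\<Sum>\<sigma>\<in>?\<Sigma>. exp (u * S \<sigma> + v * (S \<sigma>)\<^sup>2))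
    \<le> (2 ^ d * exp (real d * u\<^sup>2)) * (1 / sqrt (1 - 2 * (2 * real d * v)))"
    unfolding has_bochner_integral_integral_eq[OF sum, symmetric]
      has_bochner_integral_integral_eq[OF bound, symmetric]
  proof (rule integral_mono)
    fix g :: real
    have "(\<Sum>\<sigma>\<in>?\<Sigma>. std_normal_density g * exp ((u + c * g) * S \<sigma>))
      = std_normal_density g * (2 ^ d * cosh (u + c * g) ^ d)"
      using sum_sign_vectors_exp[OF s, of "u + c * g"]
      by (simp add: S_def sum_distrib_left[symmetric] power_mult_distrib)
    also have "\<dots> \<le> std_normal_density g * (2 ^ d * exp (real d * (u\<^sup>2 + 2 * v * g\<^sup>2)))"
    proof (intro mult_left_mono)
      have "cosh (u + c * g) \<le> exp ((u + c * g)\<^sup>2 / 2)" by (rule cosh_le_exp_half_square)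
      also have "(u + c * g)\<^sup>2 / 2 \<le> u\<^sup>2 + (c * g)\<^sup>2"
        using zero_le_power2[of "u - c * g"] by (simp add: power2_eq_square field_simps)
      also have "(c * g)\<^sup>2 = 2 * v * g\<^sup>2" by (simp add: power_mult_distrib c)
      finally have "cosh (u + c * g) ^ d \<le> exp (u\<^sup>2 + 2 * v * g\<^sup>2) ^ d"
        by (intro power_mono) auto
      then show "cosh (u + c * g) ^ d \<le> exp (real d * (u\<^sup>2 + 2 * v * g\<^sup>2))"
        by (simp add: exp_of_nat_mult)
    qed auto
    also have "\<dots> = (2 ^ d * exp (real d * u\<^sup>2)) * (std_normal_density g * exp (2 * real d * v * g\<^sup>2))"
      by (simp add: algebra_simps exp_add[symmetric] mult_exp_exp)
    finally show "(\<Sum>\<sigma>\<in>?\<Sigma>. std_normal_density g * exp ((u + c * g) * S \<sigma>))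
       \<le> (2 ^ d * exp (real d * u\<^sup>2)) * (std_normal_density g * exp (2 * real d * v * g\<^sup>2))" .
  qed (use sum bound in \<open>auto simp: has_bochner_integral_iff\<close>)
  then show ?thesis by (simp add: S_def mult.assoc)
qed

section \<open>Second moments for the two priors\<close>

lemma exp_le_quadratic:
  fixes z B :: real
  assumes "\<bar>z\<bar> \<le> B"
  shows "exp z - 1 \<le> z + exp B * z\<^sup>2"
proof -
  obtain t where t: "\<bar>t\<bar> \<le> \<bar>z\<bar>" "exp z = (\<Sum>m<2. z ^ m / fact m) + exp t / fact 2 * z ^ 2"
    using Maclaurin_exp_le[of z 2] by blast
  have "exp t / 2 * z\<^sup>2 \<le> exp B * z\<^sup>2"
  proof (intro mult_right_mono)
    have "exp t \<le> exp B" using t(1) assms by simp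
    then show "exp t / 2 \<le> exp B" using exp_ge_zero[of t] by linarith
  qed simp
  then show ?thesis using t(2) by (simp add: numeral_2_eq_2)
qed

lemma power_le_exp_of_nat:
  fixes y :: real
  assumes "- 1 \<le> y"
  shows "(1 + y) ^ n \<le> exp (real n * y)"
proof -
  have "(1 + y) ^ n \<le> exp y ^ n" using assms by (intro power_mono) auto
  then show ?thesis by (simp add: exp_of_nat_mult)
qed

text \<open>
  The weight has to exceed \<open>\<rho> / M\<close> strictly; the margin is taken so small that it costs at most \<open>\<kappa>\<close>. The
  slack \<open>\<kappa>\<close> matters for the sup norm in dimension \<open>1\<close>, where \<open>\<rho> = 0\<close>.
\<close>

lemma ex_mixing_weight:
  fixes n :: nat and \<rho> M \<kappa> :: real
  assumes "0 \<le> \<rho>" "\<rho> < M" "1 \<le> n" "0 < \<kappa>"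
  shows "\<exists>\<epsilon>>0. \<epsilon> < 1 \<and> \<rho> < \<epsilon> * M \<and> real n * \<epsilon>\<^sup>2 \<le> 2 * real n * \<rho>\<^sup>2 / M\<^sup>2 + \<kappa>"
proof -
  define a where "a = \<rho> / M"
  define b where "b = sqrt (\<kappa> / (2 * real n))"
  have a: "0 \<le> a" "a < 1" using assms by (auto simp: a_def)
  have b: "0 < b" "b\<^sup>2 = \<kappa> / (2 * real n)" using assms by (auto simp: b_def)
  define \<epsilon> where "\<epsilon> = min ((1 + a) / 2) (a + b)"
  have \<epsilon>: "a < \<epsilon>" "\<epsilon> < 1" "\<epsilon> \<le> a + b" using a b by (auto simp: \<epsilon>_def min_def)
  have "\<epsilon>\<^sup>2 \<le> (a + b)\<^sup>2" using \<epsilon> a by (intro power_mono) auto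
  also have "\<dots> \<le> 2 * a\<^sup>2 + 2 * b\<^sup>2" 
    using zero_le_power2[of "a - b"] by (simp add: power2_eq_square algebra_simps)
  finally have "real n * \<epsilon>\<^sup>2 \<le> real n * (2 * a\<^sup>2 + 2 * b\<^sup>2)" by (intro mult_left_mono) auto
  also have "\<dots> = 2 * real n * \<rho>\<^sup>2 / M\<^sup>2 + \<kappa>"
    using assms(3) by (simp add: b(2) a_def power_divide field_simps)
  finally have "real n * \<epsilon>\<^sup>2 \<le> 2 * real n * \<rho>\<^sup>2 / M\<^sup>2 + \<kappa>" .
  moreover have "0 < \<epsilon>" using \<epsilon>(1) a(1) by linarith
  moreover have "\<rho> < \<epsilon> * M" using \<epsilon>(1) assms by (simp add: a_def field_simps)
  ultimately show ?thesis using \<epsilon>(2) by blast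
qed

text \<open>
  For one fixed sign vector \<open>s\<close>, the summand is at most \<open>exp (u * S + v * S\<^sup>2)\<close>, where \<open>S\<close> is the inner product
  of the sign vectors: the linear term of \<open>exp z - 1\<close> gives \<open>u\<close> and the quadratic remainder, bounded by
  means of \<open>\<bar>z\<bar> \<le> M\<^sup>2\<close>, gives \<open>v\<close>. When \<open>n \<epsilon>\<^sup>2\<close> is of order \<open>c * sqrt d\<close>, the quantities \<open>d * u\<^sup>2\<close> and \<open>d * v\<close> are
  of order \<open>c\<^sup>2\<close> and \<open>c\<close>, uniformly in \<open>d\<close>.
\<close>

lemma sign_prior_chi_square:
  fixes n d :: nat and M \<epsilon> c \<eta> :: real
  assumes M: "0 < M" and d: "1 \<le> d" and "0 \<le> \<epsilon>" "\<epsilon> \<le> 1" and \<eta>: "0 < \<eta>" "\<eta> \<le> 1" and "0 \<le> c"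
    and c: "c \<le> \<eta> / 12" "c \<le> \<eta>\<^sup>2 / (128 * exp (M\<^sup>2) * M\<^sup>2)"
    and n\<epsilon>: "real n * \<epsilon>\<^sup>2 \<le> 4 * c * sqrt (real d) / M\<^sup>2"
    and s: "s \<in> {..<d} \<rightarrow>\<^sub>E {-1, 1}"
  shows "(\<Sum>\<sigma>\<in>{..<d} \<rightarrow>\<^sub>E {-1, 1}. (1 + \<epsilon>\<^sup>2 * (exp (M\<^sup>2 / real d * (\<Sum>j<d. \<sigma> j * s j)) - 1)) ^ n)
    \<le> 2 ^ d * (1 + \<eta>\<^sup>2)"
proof -
  let ?\<Sigma> = "{..<d} \<rightarrow>\<^sub>E {-1, 1::real}"
  define S where "S \<sigma> = (\<Sum>j<d. \<sigma> j * s j)" for \<sigma>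
  define K where "K = exp (M\<^sup>2)"
  define w where "w = sqrt (real d)"
  have w: "1 \<le> w" "real d = w * w" using d by (auto simp: w_def)
  define u where "u = real n * \<epsilon>\<^sup>2 * (M\<^sup>2 / real d)"
  define v where "v = real n * \<epsilon>\<^sup>2 * (K * (M\<^sup>2 / real d)\<^sup>2)"
  have uv: "0 \<le> u" "0 \<le> v" by (auto simp: u_def v_def K_def)
  have summand: "(1 + \<epsilon>\<^sup>2 * (exp (M\<^sup>2 / real d * S \<sigma>) - 1)) ^ n \<le> exp (u * S \<sigma> + v * (S \<sigma>)\<^sup>2)"
    if \<sigma>: "\<sigma> \<in> ?\<Sigma>" for \<sigma>
  proof -
    have "\<bar>\<sigma> j * s j\<bar> = 1" if "j < d" for j
    proof -
      have "\<sigma> j \<in> {-1, 1}" "s j \<in> {-1, 1}" using \<sigma> s that by (auto simp: PiE_iff)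
      then show ?thesis by auto
    qed
    then have "\<bar>S \<sigma>\<bar> \<le> (\<Sum>j<d. 1)" unfolding S_def by (intro order_trans[OF sum_abs] sum_mono) auto
    then have "M\<^sup>2 / real d * \<bar>S \<sigma>\<bar> \<le> M\<^sup>2 / real d * real d" by (intro mult_left_mono) auto
    then have "\<bar>M\<^sup>2 / real d * S \<sigma>\<bar> \<le> M\<^sup>2" using d by (simp add: abs_mult)
    note exp_le = exp_le_quadratic[OF this]
    have "\<epsilon>\<^sup>2 * (1 - exp (M\<^sup>2 / real d * S \<sigma>)) \<le> 1 * 1"
    proof (cases "0 \<le> 1 - exp (M\<^sup>2 / real d * S \<sigma>)")
      case True
      then show ?thesis using assms(3,4) by (intro mult_mono power_le_one) auto
    next
      case False
      then have "\<epsilon>\<^sup>2 * (1 - exp (M\<^sup>2 / real d * S \<sigma>)) \<le> 0" by (intro mult_nonneg_nonpos) auto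
      then show ?thesis by linarith
    qed
    then have "- 1 \<le> \<epsilon>\<^sup>2 * (exp (M\<^sup>2 / real d * S \<sigma>) - 1)" by (simp add: algebra_simps)
    note power_le_exp_of_nat[OF this, of n]
    also have "exp (real n * (\<epsilon>\<^sup>2 * (exp (M\<^sup>2 / real d * S \<sigma>) - 1)))
       \<le> exp (real n * (\<epsilon>\<^sup>2 * (M\<^sup>2 / real d * S \<sigma> + exp (M\<^sup>2) * (M\<^sup>2 / real d * S \<sigma>)\<^sup>2)))"
      using exp_le by (simp add: mult_left_mono)
    also have "\<dots> = exp (u * S \<sigma> + v * (S \<sigma>)\<^sup>2)"
      by (simp add: u_def v_def K_def power_mult_distrib power_divide algebra_simps)
    finally show ?thesis .
  qed
  have "u \<le> 4 * c * w / M\<^sup>2 * (M\<^sup>2 / real d)"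
    unfolding u_def using n\<epsilon> by (intro mult_right_mono) (auto simp: w_def)
  also have "\<dots> = 4 * c / w" using M w by (simp add: w(2))
  finally have u: "u \<le> 4 * c / w" .
  have "real d * u\<^sup>2 \<le> real d * (4 * c / w)\<^sup>2"
    using u uv by (intro mult_left_mono power_mono) auto
  also have "\<dots> = 16 * c\<^sup>2" using w by (simp add: w(2) power_divide power2_eq_square)
  also have "\<dots> \<le> 16 * (\<eta> / 12)\<^sup>2" using c \<open>0 \<le> c\<close> by (intro mult_left_mono power_mono) auto
  also have "\<dots> \<le> \<eta>\<^sup>2 / 8" by (simp add: power_divide)
  finally have du: "real d * u\<^sup>2 \<le> \<eta>\<^sup>2 / 8" .
  have "v \<le> 4 * c * w / M\<^sup>2 * (K * (M\<^sup>2 / real d)\<^sup>2)"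
    unfolding v_def using n\<epsilon> by (intro mult_right_mono) (auto simp: w_def K_def)
  also have "\<dots> = 4 * c * K * M\<^sup>2 / (real d * w)"
    using M w by (simp add: w(2) power2_eq_square field_simps)
  also have "\<dots> \<le> 4 * c * K * M\<^sup>2 / (real d * 1)"
    using w d \<open>0 \<le> c\<close> by (intro divide_left_mono mult_left_mono) (auto simp: K_def)
  finally have "4 * real d * v \<le> 16 * c * K * M\<^sup>2" using d by (simp add: field_simps)
  also have "\<dots> \<le> \<eta>\<^sup>2 / 8" using c(2) M by (simp add: K_def field_simps)
  finally have dv: "4 * real d * v \<le> \<eta>\<^sup>2 / 8" .
  have \<eta>2: "\<eta>\<^sup>2 \<le> 1" "0 < \<eta>\<^sup>2" using \<eta> by (auto intro: power_le_one)
  have "(\<Sum>\<sigma>\<in>?\<Sigma>. (1 + \<epsilon>\<^sup>2 * (exp (M\<^sup>2 / real d * S \<sigma>) - 1)) ^ n) \<le> (\<Sum>\<sigma>\<in>?\<Sigma>. exp (u * S \<sigma> + v * (S \<sigma>)\<^sup>2))"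
    by (intro sum_mono summand)
  also have "\<dots> \<le> 2 ^ d * (exp (real d * u\<^sup>2) / sqrt (1 - 4 * real d * v))"
    unfolding S_def using dv \<eta>2 by (intro sum_sign_vectors_exp_quadratic s uv) linarith
  also have "\<dots> \<le> 2 ^ d * ((1 + \<eta>\<^sup>2 / 4) * (1 + \<eta>\<^sup>2 / 4))"
  proof (intro mult_left_mono)
    define x where "x = 4 * real d * v"
    have x: "0 \<le> x" "x \<le> \<eta>\<^sup>2 / 8" "x \<le> 1 / 2" using dv uv \<eta>2 by (auto simp: x_def)
    have "exp (real d * u\<^sup>2) \<le> exp (\<eta>\<^sup>2 / 8)" using du by simp
    also have "\<dots> \<le> 1 + \<eta>\<^sup>2 / 8 + (\<eta>\<^sup>2 / 8)\<^sup>2" using \<eta>2 by (intro exp_bound) auto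
    also have "\<dots> \<le> 1 + \<eta>\<^sup>2 / 4"
    proof -
      have "(\<eta>\<^sup>2 / 8)\<^sup>2 = \<eta>\<^sup>2 * \<eta>\<^sup>2 / 64" by (simp add: power2_eq_square)
      then show ?thesis using \<eta>2 mult_left_le[of "\<eta>\<^sup>2" "\<eta>\<^sup>2"] by linarith
    qed
    finally have e: "exp (real d * u\<^sup>2) \<le> 1 + \<eta>\<^sup>2 / 4" .
    have "1 \<le> (1 - x) * (1 + \<eta>\<^sup>2 / 4)"
    proof -
      have "1 \<le> (1 - x) * (1 + 2 * x)" using x mult_nonneg_nonneg[of x "1 - 2 * x"] by (simp add: algebra_simps)
      also have "\<dots> \<le> (1 - x) * (1 + \<eta>\<^sup>2 / 4)" using x by (intro mult_left_mono) auto
      finally show ?thesis .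
    qed
    also have "\<dots> \<le> sqrt (1 - x) * (1 + \<eta>\<^sup>2 / 4)"
    proof (intro mult_right_mono real_le_rsqrt)
      show "(1 - x)\<^sup>2 \<le> 1 - x" using x mult_left_le[of "1 - x" "1 - x"] by (simp add: power2_eq_square)
    qed auto
    finally have "1 / sqrt (1 - x) \<le> 1 + \<eta>\<^sup>2 / 4" using x by (simp add: field_simps)
    then have "exp (real d * u\<^sup>2) * (1 / sqrt (1 - x)) \<le> (1 + \<eta>\<^sup>2 / 4) * (1 + \<eta>\<^sup>2 / 4)"
      using e x by (intro mult_mono) auto
    then show "exp (real d * u\<^sup>2) / sqrt (1 - 4 * real d * v) \<le> (1 + \<eta>\<^sup>2 / 4) * (1 + \<eta>\<^sup>2 / 4)"
      by (simp add: x_def)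
  qed simp
  also have "\<dots> \<le> 2 ^ d * (1 + \<eta>\<^sup>2)"
  proof (intro mult_left_mono)
    have "(1 + \<eta>\<^sup>2 / 4) * (1 + \<eta>\<^sup>2 / 4) = 1 + \<eta>\<^sup>2 / 2 + \<eta>\<^sup>2 * \<eta>\<^sup>2 / 16"
      by (simp add: algebra_simps)
    then show "(1 + \<eta>\<^sup>2 / 4) * (1 + \<eta>\<^sup>2 / 4) \<le> 1 + \<eta>\<^sup>2"
      using \<eta>2 mult_left_le[of "\<eta>\<^sup>2" "\<eta>\<^sup>2"] by linarith
  qed simp
  finally show ?thesis by (simp add: S_def)
qed

text \<open>
  Only the \<open>d\<close> diagonal terms differ from \<open>1\<close>. They exceed \<open>1\<close> by at most \<open>exp E - 1 \<le> E * exp E\<close> with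
  \<open>E \<le> \<gamma> * (ln d + 1)\<close>. Since \<open>\<gamma> \<le> 1 / 2\<close>, one has \<open>E \<le> 2 * \<gamma> * sqrt d\<close> and \<open>exp E \<le> 2 * sqrt d\<close>, and the
  excess is at most \<open>4 * \<gamma> * d\<close>.
\<close>

lemma spike_prior_chi_square:
  fixes n d :: nat and B \<epsilon> \<gamma> \<eta> :: real
  assumes d: "1 \<le> d" and "0 \<le> B" and "\<gamma> \<le> 1 / 2" "4 * \<gamma> \<le> \<eta>\<^sup>2" "0 \<le> \<gamma>"
    and n\<epsilon>: "real n * \<epsilon>\<^sup>2 * B \<le> \<gamma> * (ln (real d) + 1)"
  shows "(\<Sum>j<d. \<Sum>k<d. (1 + \<epsilon>\<^sup>2 * (if j = k then B else 0)) ^ n) \<le> (real d)\<^sup>2 * (1 + \<eta>\<^sup>2)"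
proof -
  define E where "E = real n * \<epsilon>\<^sup>2 * B"
  define w where "w = sqrt (real d)"
  have w: "1 \<le> w" "real d = w * w" using d by (auto simp: w_def)
  have E0: "0 \<le> E" using \<open>0 \<le> B\<close> by (simp add: E_def)
  have ln_d: "ln (real d) = 2 * ln w" unfolding w(2) using w(1) by (simp add: ln_mult)
  then have ln: "ln (real d) + 1 \<le> 2 * w" using ln_le_minus_one[of w] w(1) by simp
  have E1: "E \<le> \<gamma> * (2 * w)"
    using n\<epsilon> mult_left_mono[OF ln \<open>0 \<le> \<gamma>\<close>] unfolding E_def by (rule order_trans)
  have "\<gamma> * (ln (real d) + 1) \<le> 1 / 2 * (ln (real d) + 1)"
    using assms(3) d by (intro mult_right_mono) (auto simp: add_nonneg_nonneg)
  with n\<epsilon> have "E \<le> 1 / 2 * (ln (real d) + 1)"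
    unfolding E_def by (rule order_trans)
  then have "E \<le> ln w + 1 / 2" using ln_d by simp
  then have "exp E \<le> exp (ln w + 1 / 2)" by simp
  also have "\<dots> = w * exp (1 / 2)" using w(1) by (simp add: exp_add)
  also have "\<dots> \<le> w * 2"
  proof (intro mult_left_mono)
    have "exp (1 / 2 :: real) \<le> 1 + 1 / 2 + (1 / 2)\<^sup>2" by (rule exp_bound) auto
    then show "exp (1 / 2 :: real) \<le> 2" by (simp add: power2_eq_square)
  qed (use w in auto)
  finally have E2: "exp E \<le> w * 2" .
  have "exp E - 1 \<le> E * exp E"
  proof -
    have "exp E * (1 - E) \<le> exp E * exp (- E)" using exp_ge_add_one_self[of "- E"] by (intro mult_left_mono) auto
    then show ?thesis by (simp add: exp_minus algebra_simps)
  qed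
  also have "\<dots> \<le> (\<gamma> * (2 * w)) * (w * 2)" using E0 E1 E2 by (intro mult_mono) auto
  also have "\<dots> = 4 * \<gamma> * real d" by (simp add: w(2))
  also have "\<dots> \<le> \<eta>\<^sup>2 * real d" using assms(4) by (intro mult_right_mono) auto
  finally have expE: "exp E - 1 \<le> \<eta>\<^sup>2 * real d" .
  have "(\<Sum>j<d. \<Sum>k<d. (1 + \<epsilon>\<^sup>2 * (if j = k then B else 0)) ^ n)
     = (\<Sum>j<d. \<Sum>k<d. 1 + (if j = k then (1 + \<epsilon>\<^sup>2 * B) ^ n - 1 else 0))"
    by (intro sum.cong) auto
  also have "\<dots> = (real d)\<^sup>2 + real d * ((1 + \<epsilon>\<^sup>2 * B) ^ n - 1)"
    by (simp add: sum.distrib power2_eq_square[of "real d"] distrib_left)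
  also have "\<dots> \<le> (real d)\<^sup>2 + real d * (\<eta>\<^sup>2 * real d)"
  proof (intro add_left_mono mult_left_mono)
    have "(1 + \<epsilon>\<^sup>2 * B) ^ n \<le> exp E"
      using power_le_exp_of_nat[of "\<epsilon>\<^sup>2 * B" n] \<open>0 \<le> B\<close> by (simp add: E_def mult.assoc order_trans[of "-1" 0])
    then show "(1 + \<epsilon>\<^sup>2 * B) ^ n - 1 \<le> \<eta>\<^sup>2 * real d" using expE by linarith
  qed simp
  also have "\<dots> = (real d)\<^sup>2 * (1 + \<eta>\<^sup>2)" by (simp add: power2_eq_square algebra_simps)
  finally show ?thesis .
qed

section \<open>The lower bounds and the separation rates\<close>

text \<open>
  Since \<open>\<epsilon> < 1\<close>, a nonempty alternative forces the separation below the radius, which leaves room for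
  vectors of norm \<open>M\<close> with a weight above \<open>\<rho> / M\<close>.
\<close>

lemma separation_lt_radius:
  assumes "separated_class N d M \<rho> \<noteq> {}" "0 \<le> \<rho>" and "\<And>\<mu>. 0 \<le> N d \<mu>"
  shows "\<rho> < M"
proof -
  obtain \<epsilon> \<mu> where "(\<epsilon>, \<mu>) \<in> separated_class N d M \<rho>" using assms(1) by auto
  note sep = separated_classD[OF this]
  have "\<epsilon> * N d \<mu> \<le> 1 * N d \<mu>" using sep(2) assms(3) by (intro mult_right_mono) auto
  then show ?thesis using sep by linarith
qed

lemma norm_sup_nonneg: "1 \<le> d \<Longrightarrow> 0 \<le> norm_sup d \<mu>"
  by (metis norm_sup_attained abs_ge_zero)

definition sign_vector :: "real \<Rightarrow> nat \<Rightarrow> (nat \<Rightarrow> real) \<Rightarrow> nat \<Rightarrow> real" where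
  "sign_vector M d \<sigma> = (\<lambda>j\<in>{..<d}. M / sqrt (real d) * \<sigma> j)"

lemma inner_sign_vector:
  "(\<Sum>j<d. sign_vector M d \<sigma> j * sign_vector M d \<tau> j) = M\<^sup>2 / real d * (\<Sum>j<d. \<sigma> j * \<tau> j)"
  by (simp add: sign_vector_def sum_distrib_left power2_eq_square mult_ac)

lemma norm2_sign_vector:
  assumes "1 \<le> d" "0 < M" "\<sigma> \<in> {..<d} \<rightarrow>\<^sub>E {-1, 1}"
  shows "norm2 d (sign_vector M d \<sigma>) = M"
proof -
  have "\<sigma> j * \<sigma> j = 1" if "j < d" for j
  proof -
    have "\<sigma> j \<in> {-1, 1}" using assms(3) that by (auto simp: PiE_iff)
    then show ?thesis by auto
  qed
  then have "(norm2 d (sign_vector M d \<sigma>))\<^sup>2 = M\<^sup>2"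
    using assms(1) inner_sign_vector[of M d \<sigma> \<sigma>]
    unfolding norm2_power2 by (simp add: power2_eq_square)
  then show ?thesis using assms(2) norm2_nonneg by (metis less_imp_le power2_eq_imp_eq)
qed

lemma l2_lower_bound:
  fixes M \<alpha> \<eta> c :: real and n d :: nat
  defines "\<rho> \<equiv> sqrt c * real d powr (1/4) / sqrt (real n)"
  assumes M: "0 < M" and "0 \<le> \<alpha>" and \<eta>: "0 < \<eta>" "\<eta> \<le> 1" and n: "1 \<le> n" and d: "1 \<le> d" and "0 < c"
    and c: "c \<le> \<eta> / 12" "c \<le> \<eta>\<^sup>2 / (128 * exp (M\<^sup>2) * M\<^sup>2)"
    and ne: "separated_class norm2 d M \<rho> \<noteq> {}" and \<Psi>: "\<Psi> \<in> level_tests n d \<alpha>"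
  shows "ennreal (1 - \<alpha> - \<eta>) \<le> worst_error n d (separated_class norm2 d M \<rho>) \<Psi>"
proof -
  have \<rho>0: "0 \<le> \<rho>" using \<open>0 < c\<close> by (simp add: \<rho>_def)
  have n\<rho>: "real n * \<rho>\<^sup>2 = c * sqrt (real d)"
  proof -
    have "(real d powr (1/4))\<^sup>2 = sqrt (real d)"
      using d by (simp add: powr_power powr_half_sqrt)
    then show ?thesis using n \<open>0 < c\<close> by (simp add: \<rho>_def power_divide power_mult_distrib)
  qed
  have "\<rho> < M" using ne \<rho>0 by (rule separation_lt_radius) (rule norm2_nonneg)
  then obtain \<epsilon> where \<epsilon>: "0 < \<epsilon>" "\<epsilon> < 1" "\<rho> < \<epsilon> * M"
      "real n * \<epsilon>\<^sup>2 \<le> 2 * real n * \<rho>\<^sup>2 / M\<^sup>2 + 2 * c / M\<^sup>2"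
    using ex_mixing_weight[OF \<rho>0 _ n, of M "2 * c / M\<^sup>2"] \<open>0 < c\<close> M by auto
  have "real n * \<epsilon>\<^sup>2 \<le> 2 * (c * sqrt (real d)) / M\<^sup>2 + 2 * c * 1 / M\<^sup>2"
    using \<epsilon>(4) by (simp add: n\<rho>[symmetric] mult_ac)
  also have "\<dots> \<le> 2 * (c * sqrt (real d)) / M\<^sup>2 + 2 * c * sqrt (real d) / M\<^sup>2"
    using d \<open>0 < c\<close> by (intro add_left_mono divide_right_mono mult_left_mono) auto
  finally have n\<epsilon>: "real n * \<epsilon>\<^sup>2 \<le> 4 * c * sqrt (real d) / M\<^sup>2" by simp
  let ?\<Sigma> = "{..<d} \<rightarrow>\<^sub>E {-1, 1::real}"
  have card: "real (card ?\<Sigma>) = 2 ^ d" by (simp add: card_PiE)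
  show ?thesis
  proof (rule worst_error_lower_bound[where \<Theta>="?\<Sigma>" and \<mu>="sign_vector M d" and \<epsilon>=\<epsilon>])
    show "finite ?\<Sigma>" by (intro finite_PiE) auto
    show "?\<Sigma> \<noteq> {}" by (simp add: PiE_eq_empty_iff)
    show "(\<epsilon>, sign_vector M d \<sigma>) \<in> separated_class norm2 d M \<rho>" if "\<sigma> \<in> ?\<Sigma>" for \<sigma>
      using \<epsilon> norm2_sign_vector[OF d M that]
      by (auto simp: separated_class_def mixture_class_def sign_vector_def)
    have "(\<Sum>s\<in>?\<Sigma>. \<Sum>\<sigma>\<in>?\<Sigma>. (1 + \<epsilon>\<^sup>2 * (exp (\<Sum>j<d. sign_vector M d s j * sign_vector M d \<sigma> j) - 1)) ^ n)
      \<le> (\<Sum>s\<in>?\<Sigma>. 2 ^ d * (1 + \<eta>\<^sup>2))"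
    proof (intro sum_mono)
      fix s assume "s \<in> ?\<Sigma>"
      from sign_prior_chi_square[OF M d _ _ \<eta> _ c n\<epsilon> this]
      show "(\<Sum>\<sigma>\<in>?\<Sigma>. (1 + \<epsilon>\<^sup>2 * (exp (\<Sum>j<d. sign_vector M d s j * sign_vector M d \<sigma> j) - 1)) ^ n)
        \<le> 2 ^ d * (1 + \<eta>\<^sup>2)"
        using \<epsilon> \<open>0 < c\<close> by (simp add: inner_sign_vector mult.commute[of "s _"])
    qed
    then show "(\<Sum>s\<in>?\<Sigma>. \<Sum>\<sigma>\<in>?\<Sigma>. (1 + \<epsilon>\<^sup>2 * (exp (\<Sum>j<d. sign_vector M d s j * sign_vector M d \<sigma> j) - 1)) ^ n)
      \<le> (real (card ?\<Sigma>))\<^sup>2 * (1 + \<eta>\<^sup>2)"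
      by (simp add: card power2_eq_square[of "2 ^ d"] mult.assoc)
  qed (use \<epsilon> \<eta> \<Psi> \<open>0 \<le> \<alpha>\<close> in auto)
qed

definition spike :: "real \<Rightarrow> nat \<Rightarrow> nat \<Rightarrow> nat \<Rightarrow> real" where
  "spike M d j = (\<lambda>i\<in>{..<d}. if i = j then M else 0)"

lemma norm_sup_spike:
  assumes "j < d" "0 < M"
  shows "norm_sup d (spike M d j) = M"
  unfolding norm_sup_def
proof (rule Max_eqI)
  show "M \<in> (\<lambda>i. \<bar>spike M d j i\<bar>) ` {..<d}"
    using assms by (intro image_eqI[of _ _ j]) (auto simp: spike_def)
qed (use assms in \<open>auto simp: spike_def\<close>)

lemma inner_spike:
  assumes "j < d" "k < d"
  shows "(\<Sum>i<d. spike M d j i * spike M d k i) = (if j = k then M\<^sup>2 else 0)"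
proof -
  have "(\<Sum>i<d. spike M d j i * spike M d k i) = (\<Sum>i<d. if i = j then (if j = k then M\<^sup>2 else 0) else 0)"
    by (intro sum.cong) (auto simp: spike_def power2_eq_square)
  then show ?thesis using assms by simp
qed

lemma sup_lower_bound:
  fixes M \<alpha> \<eta> c :: real and n d :: nat
  defines "\<rho> \<equiv> sqrt c * sqrt (ln (real d) / real n)"
  assumes M: "0 < M" and "0 \<le> \<alpha>" and \<eta>: "0 < \<eta>" "\<eta> \<le> 1" and n: "1 \<le> n" and d: "1 \<le> d" and "0 < c"
    and c: "8 * c * (exp (M\<^sup>2) - 1) / M\<^sup>2 \<le> \<eta>\<^sup>2"
    and ne: "separated_class norm_sup d M \<rho> \<noteq> {}" and \<Psi>: "\<Psi> \<in> level_tests n d \<alpha>"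
  shows "ennreal (1 - \<alpha> - \<eta>) \<le> worst_error n d (separated_class norm_sup d M \<rho>) \<Psi>"
proof -
  define B where "B = exp (M\<^sup>2) - 1"
  have B: "0 \<le> B" by (simp add: B_def)
  define \<gamma> where "\<gamma> = 2 * c * B / M\<^sup>2"
  have "4 * \<gamma> \<le> \<eta>\<^sup>2" "\<eta>\<^sup>2 \<le> 1" using c \<eta> by (auto simp: \<gamma>_def B_def intro: power_le_one)
  then have \<gamma>: "\<gamma> \<le> 1 / 2" "4 * \<gamma> \<le> \<eta>\<^sup>2" "0 \<le> \<gamma>"
    using B \<open>0 < c\<close> by (linarith, linarith, simp add: \<gamma>_def)
  have \<rho>0: "0 \<le> \<rho>" using \<open>0 < c\<close> d by (simp add: \<rho>_def)
  have n\<rho>: "real n * \<rho>\<^sup>2 = c * ln (real d)"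
    using n \<open>0 < c\<close> d by (simp add: \<rho>_def power_mult_distrib)
  have "\<rho> < M" using ne \<rho>0 by (rule separation_lt_radius) (rule norm_sup_nonneg[OF d])
  then obtain \<epsilon> where \<epsilon>: "0 < \<epsilon>" "\<epsilon> < 1" "\<rho> < \<epsilon> * M"
      "real n * \<epsilon>\<^sup>2 \<le> 2 * real n * \<rho>\<^sup>2 / M\<^sup>2 + 2 * c / M\<^sup>2"
    using ex_mixing_weight[OF \<rho>0 _ n, of M "2 * c / M\<^sup>2"] \<open>0 < c\<close> M by auto
  have "real n * \<epsilon>\<^sup>2 \<le> 2 * (c * ln (real d)) / M\<^sup>2 + 2 * c / M\<^sup>2"
    using \<epsilon>(4) by (simp add: n\<rho>[symmetric] mult_ac)
  from mult_right_mono[OF this B]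
  have n\<epsilon>: "real n * \<epsilon>\<^sup>2 * B \<le> \<gamma> * (ln (real d) + 1)"
    by (simp add: \<gamma>_def add_divide_distrib algebra_simps)
  show ?thesis
  proof (rule worst_error_lower_bound[where \<Theta>="{..<d}" and \<mu>="spike M d" and \<epsilon>=\<epsilon>])
    show "{..<d} \<noteq> {}" using d by (auto simp: lessThan_empty_iff)
    show "(\<epsilon>, spike M d j) \<in> separated_class norm_sup d M \<rho>" if "j \<in> {..<d}" for j
      using \<epsilon> norm_sup_spike[of j d M] M that
      by (auto simp: separated_class_def mixture_class_def spike_def)
    have "(\<Sum>j<d. \<Sum>k<d. (1 + \<epsilon>\<^sup>2 * (exp (\<Sum>i<d. spike M d j i * spike M d k i) - 1)) ^ n)
      = (\<Sum>j<d. \<Sum>k<d. (1 + \<epsilon>\<^sup>2 * (if j = k then B else 0)) ^ n)"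
      by (intro sum.cong) (auto simp: inner_spike B_def)
    also have "\<dots> \<le> (real d)\<^sup>2 * (1 + \<eta>\<^sup>2)"
      by (rule spike_prior_chi_square[OF d B \<gamma> n\<epsilon>])
    finally show "(\<Sum>j<d. \<Sum>k<d. (1 + \<epsilon>\<^sup>2 * (exp (\<Sum>i<d. spike M d j i * spike M d k i) - 1)) ^ n)
      \<le> (real (card {..<d}))\<^sup>2 * (1 + \<eta>\<^sup>2)" by simp
  qed (use \<epsilon> \<eta> \<Psi> \<open>0 \<le> \<alpha>\<close> in auto)
qed

lemma INF_level_tests_gt:
  assumes "\<And>\<Psi>. \<Psi> \<in> T \<Longrightarrow> ennreal b \<le> e \<Psi>" "0 \<le> \<beta>" "\<beta> < b"
  shows "(INF \<Psi>\<in>T. e \<Psi>) > ennreal \<beta>"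
proof -
  have "ennreal \<beta> < ennreal b" using assms by (intro ennreal_lessI) auto
  also have "\<dots> \<le> (INF \<Psi>\<in>T. e \<Psi>)" by (intro INF_greatest assms)
  finally show ?thesis .
qed

theorem theorem1:
  fixes M \<alpha> \<beta> :: real
  assumes "0 < M" and "0 < \<alpha>" and "\<alpha> < 1" and "0 < \<beta>" and "\<beta> < 1"
  shows "\<exists>Cp Cm :: real. 0 < Cp \<and> 0 < Cm \<and> (\<forall>n\<ge>(1::nat). \<forall>d\<ge>(1::nat).
    (let A2 = (\<lambda>C. separated_class norm2 d M (C * real d powr (1/4) / sqrt (real n)));
         Ainf = (\<lambda>C. separated_class norm_sup d M (C * sqrt (ln (real d) / real n)))
     in
       (\<exists>\<Psi>\<in>level_tests n d \<alpha>. worst_error n d (A2 Cp) \<Psi> \<le> ennreal \<beta>) \<and>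
       (\<alpha> + \<beta> < 1 \<and> A2 Cm \<noteq> {} \<longrightarrow>
          (INF \<Psi>\<in>level_tests n d \<alpha>. worst_error n d (A2 Cm) \<Psi>) > ennreal \<beta>) \<and>
       (2 \<le> d \<longrightarrow> (\<exists>\<Psi>\<in>level_tests n d \<alpha>. worst_error n d (Ainf Cp) \<Psi> \<le> ennreal \<beta>)) \<and>
       (\<alpha> + \<beta> < 1 \<and> Ainf Cm \<noteq> {} \<longrightarrow>
          (INF \<Psi>\<in>level_tests n d \<alpha>. worst_error n d (Ainf Cm) \<Psi>) > ennreal \<beta>)))"
proof -
  define b1 b2 b3 b4 where "b1 = 36 * (1 + M\<^sup>2) / \<beta>" and "b2 = 6 / sqrt \<alpha>"
    and "b3 = 4 * (1 + M\<^sup>2) / (\<beta> * ln 2)" and "b4 = 8 * (1 + ln (2 / \<alpha>) / ln 2)"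
  have b: "0 \<le> b1" "0 \<le> b2" "0 \<le> b3" "0 \<le> b4"
    using assms by (auto simp: b1_def b2_def b3_def b4_def add_nonneg_nonneg)
  define Cp where "Cp = M + sqrt (b1 + b2 + b3 + b4)"
  have Cp: "M \<le> Cp" "0 < Cp" using b assms by (auto simp: Cp_def add_pos_nonneg)
  have "b1 + b2 + b3 + b4 = (sqrt (b1 + b2 + b3 + b4))\<^sup>2" using b by simp
  also have "\<dots> \<le> Cp\<^sup>2" using b \<open>0 < M\<close> by (intro power_mono) (auto simp: Cp_def)
  finally have Cp2: "b1 \<le> Cp\<^sup>2" "b2 \<le> Cp\<^sup>2" "b3 \<le> Cp\<^sup>2" "b4 \<le> Cp\<^sup>2" using b by linarith+
  define \<eta> where "\<eta> = (if \<alpha> + \<beta> < 1 then (1 - \<alpha> - \<beta>) / 2 else 1)"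
  have \<eta>: "0 < \<eta>" "\<eta> \<le> 1" using assms by (auto simp: \<eta>_def)
  have B: "0 < exp (M\<^sup>2) - 1" using \<open>0 < M\<close> by simp
  define c where "c = Min {\<eta> / 12, \<eta>\<^sup>2 / (128 * exp (M\<^sup>2) * M\<^sup>2), \<eta>\<^sup>2 * M\<^sup>2 / (8 * (exp (M\<^sup>2) - 1))}"
  have "0 < c" using \<eta> B \<open>0 < M\<close> by (auto simp: c_def)
  have c: "c \<le> \<eta> / 12" "c \<le> \<eta>\<^sup>2 / (128 * exp (M\<^sup>2) * M\<^sup>2)" "c \<le> \<eta>\<^sup>2 * M\<^sup>2 / (8 * (exp (M\<^sup>2) - 1))"
    by (simp_all only: c_def Min_le finite.intros insert_iff simp_thms)
  have c3: "8 * c * (exp (M\<^sup>2) - 1) / M\<^sup>2 \<le> \<eta>\<^sup>2"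
  proof -
    have "c * (8 * (exp (M\<^sup>2) - 1)) \<le> \<eta>\<^sup>2 * M\<^sup>2" using c(3) B by (subst (asm) pos_le_divide_eq) auto
    then show ?thesis using \<open>0 < M\<close> by (subst pos_divide_le_eq) (auto simp: mult_ac)
  qed
  \<comment> \<open>The gap \<open>1 - \<alpha> - \<beta>\<close> is split evenly: half of it pays for the distance between the null and the mixed
    law, the other half makes the bound strict.\<close>
  have gap: "\<beta> < 1 - \<alpha> - \<eta>" if "\<alpha> + \<beta> < 1" using that by (simp add: \<eta>_def field_simps)
  show ?thesis
    unfolding Let_def
  proof (rule exI[of _ Cp], rule exI[of _ "sqrt c"], intro conjI allI impI)
    fix n d :: nat assume nd: "1 \<le> n" "1 \<le> d"
    show "\<exists>\<Psi>\<in>level_tests n d \<alpha>.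
        worst_error n d (separated_class norm2 d M (Cp * real d powr (1/4) / sqrt (real n))) \<Psi> \<le> ennreal \<beta>"
      using assms nd Cp Cp2 by (intro l2_upper_bound) (auto simp: b1_def b2_def)
    show "\<exists>\<Psi>\<in>level_tests n d \<alpha>.
        worst_error n d (separated_class norm_sup d M (Cp * sqrt (ln (real d) / real n))) \<Psi> \<le> ennreal \<beta>"
      if "2 \<le> d"
      using assms nd Cp Cp2 that by (intro sup_upper_bound) (auto simp: b3_def b4_def)
    show "ennreal \<beta> < (INF \<Psi>\<in>level_tests n d \<alpha>.
        worst_error n d (separated_class norm2 d M (sqrt c * real d powr (1/4) / sqrt (real n))) \<Psi>)"
      if "\<alpha> + \<beta> < 1 \<and> separated_class norm2 d M (sqrt c * real d powr (1/4) / sqrt (real n)) \<noteq> {}"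
      using assms nd that \<eta> c \<open>0 < c\<close> gap
      by (intro INF_level_tests_gt[of _ "1 - \<alpha> - \<eta>"] l2_lower_bound) auto
    show "ennreal \<beta> < (INF \<Psi>\<in>level_tests n d \<alpha>.
        worst_error n d (separated_class norm_sup d M (sqrt c * sqrt (ln (real d) / real n))) \<Psi>)"
      if "\<alpha> + \<beta> < 1 \<and> separated_class norm_sup d M (sqrt c * sqrt (ln (real d) / real n)) \<noteq> {}"
      using assms nd that \<eta> c3 \<open>0 < c\<close> gap
      by (intro INF_level_tests_gt[of _ "1 - \<alpha> - \<eta>"] sup_lower_bound) auto
  qed (use Cp \<open>0 < c\<close> in auto)
qed

end
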